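(* Let $(K,v)$ be a valued field with $\mathrm{rk}\, vK=n$ a finite positive integer, let $\overline v$ be an extension of $v$ to an algebraic closure $\overline K$ of $K$, and identify $\overline v\overline K$ with $(\Gamma_1\oplus\dots\oplus\Gamma_n)_{\mathrm{lex}}$, where the $\Gamma_i$ are subgroups of $\mathbb R$. Let $E=\{z_\nu\}_{\nu<\lambda}$ be a pseudo convergent sequence of algebraic type in $(K,v)$ and write $\delta_\nu=(\delta_{1,\nu},\dots,\delta_{n,\nu})$. Put $\nu_0:=0$. Let $1\le i\le n$ and suppose that for each $1\le j<i$ there are $r_j\in\Gamma_j$ and $\nu_j$ with $\nu_{j-1}\le\nu_j<\lambda$ such that $\sup\{\delta_{j,\nu}\}_{\nu\ge\nu_{j-1}}=r_j=\delta_{j,\nu}$ for all $\nu\ge\nu_j$ (no condition if $i=1$). Then $\{\delta_{i,\nu}\}_{\nu\ge\nu_{i-1}}$ is an increasing (i.e. non-decreasing) sequence; let $r_i:=\sup\{\delta_{i,\nu}\}_{\nu\ge\nu_{i-1}}\in\mathbb R\cup\{\infty\}$. Then: (a) if $r_i=\infty$, then $\mathrm{rk}\, v_EK(X)=\mathrm{rk}\, vK+1$; (b) if $r_i\in\mathbb R\setminus\Gamma_i$, then $\mathrm{rk}\, v_EK(X)=\mathrm{rk}\, vK$; (c) if $r_i\in\Gamma_i$ and $r_i>\delta_{i,\nu}$ for all $\nu\ge\nu_{i-1}$, then $\mathrm{rk}\, v_EK(X)=\mathrm{rk}\, vK+1$; (d) otherwise $r_i\in\Gamma_i$ and there is $\nu_i$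 with $\nu_{i-1}\le\nu_i<\lambda$ and $r_i=\delta_{i,\nu}$ for all $\nu\ge\nu_i$ (so the procedure continues with $i+1$); this last case does not occur for $i=n$.
   Context: Conventions. A valued field $(K,v)$ is a field with a (Krull) valuation, value group $vK$ (written additively). The rank $\mathrm{rk}\,\Gamma$ of an ordered abelian group $\Gamma$ is the order type of the set, ordered by inclusion, of its isolated subgroups, i.e. of the proper subgroups $\Delta$ such that $\alpha\in\Delta$, $\beta\in\Gamma$, $-\alpha\le\beta\le\alpha$ imply $\beta\in\Delta$. If $\mathrm{rk}\, vK=n$ is a positive integer, then $\overline v\overline K$ is order isomorphic to $(\Gamma_1\oplus\dots\oplus\Gamma_n)_{\mathrm{lex}}$ (lexicographic order) for some subgroups $\Gamma_i$ of $\mathbb R$. Let $\lambda$ be a limit ordinal. $E=\{z_\nu\}_{\nu<\lambda}\subseteq K$ is pseudo convergent if $v(z_{\nu_1}-z_{\nu_2})<v(z_{\nu_2}-z_{\nu_3})$ for all $\nu_1<\nu_2<\nu_3<\lambda$; then $\delta_\nu:=v(z_\nu-z_{\nu+1})$. It is of algebraic type if $\{vf(z_\nu)\}_{\nu<\lambda}$ is not ultimately constant for some $f\in K[X]$. $v_E$ is the valuation of $K(X)$ with valuation ring $\{\phi\in K(X)\mid v\phi(z_\nu)\ge 0$ for all sufficiently large $\nu\}$ (maximal ideal given by $v\phi(z_\nu)>0$ for all sufficiently large $\nu$); it extends $v$, and $v_EK(X)$ is its value group. *)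

theory Defs
  imports
    "HOL-Algebra.Algebraic_Closure_Type"
    "HOL-Computational_Algebra.Fraction_Field"
    "HOL-Library.Extended"
    "HOL-Library.Extended_Real"
    "HOL-Library.FuncSet"
begin

(* Reserve the infinity symbol for the extended reals; the value of 0 under a valuation is Pinf. *)
no_notation Pinf (\<open>\<infinity>\<close>) and Minf (\<open>-\<infinity>\<close>)

section \<open>Ordered abelian groups\<close>

(* An ordered abelian group is represented by a subgroup G of a linearly ordered type; in
   particular value groups need not exhaust the type in which a valuation takes its values. *)

definition add_subgroup :: "'a::ab_group_add set \<Rightarrow> bool" where
  "add_subgroup D \<longleftrightarrow>
     0 \<in> D \<and> (\<forall>a\<in>D. \<forall>b\<in>D. a + b \<in> D) \<and> (\<forall>a\<in>D. - a \<in> D)"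

definition isolated_subgroups :: "'g::linordered_ab_group_add set \<Rightarrow> 'g set set" where
  "isolated_subgroups G =
     {D. add_subgroup D \<and> D \<subset> G \<and>
         (\<forall>\<alpha>\<in>D. \<forall>\<beta>\<in>G. - \<alpha> \<le> \<beta> \<and> \<beta> \<le> \<alpha> \<longrightarrow> \<beta> \<in> D)}"

(* The order type of the isolated subgroups is the finite ordinal n = {0, ..., n - 1}. *)
definition has_rank :: "'g::linordered_ab_group_add set \<Rightarrow> nat \<Rightarrow> bool" where
  "has_rank G n \<longleftrightarrow>
     (\<exists>h. bij_betw h (isolated_subgroups G) {..<n} \<and>
          (\<forall>A\<in>isolated_subgroups G. \<forall>B\<in>isolated_subgroups G. A \<subseteq> B \<longleftrightarrow> h A \<le> h B))"

definition lex_less :: "nat \<Rightarrow> (nat \<Rightarrow> real) \<Rightarrow> (nat \<Rightarrow> real) \<Rightarrow> bool" where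
  "lex_less n x y \<longleftrightarrow> (\<exists>k\<in>{1..n}. (\<forall>j\<in>{1..<k}. x j = y j) \<and> x k < y k)"

(* c is an isomorphism of ordered groups from G onto the lexicographically ordered direct sum
   of \<Gamma> 1, ..., \<Gamma> n; the i-th component of g is c g i. *)
definition lex_identification ::
    "'g::linordered_ab_group_add set \<Rightarrow> nat \<Rightarrow> (nat \<Rightarrow> real set) \<Rightarrow> ('g \<Rightarrow> nat \<Rightarrow> real) \<Rightarrow> bool" where
  "lex_identification G n \<Gamma> c \<longleftrightarrow>
     bij_betw c G (\<Pi>\<^sub>E i\<in>{1..n}. \<Gamma> i) \<and>
     (\<forall>a\<in>G. \<forall>b\<in>G. \<forall>i\<in>{1..n}. c (a + b) i = c a i + c b i) \<and>
     (\<forall>a\<in>G. \<forall>b\<in>G. a < b \<longleftrightarrow> lex_less n (c a) (c b))"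

section \<open>Valuations\<close>

definition is_valuation :: "('k::field \<Rightarrow> 'g::linordered_ab_group_add extended) \<Rightarrow> bool" where
  "is_valuation v \<longleftrightarrow>
     (\<forall>x. v x \<noteq> Minf) \<and>
     (\<forall>x. v x = Pinf \<longleftrightarrow> x = 0) \<and>
     (\<forall>x y. v (x * y) = v x + v y) \<and>
     (\<forall>x y. min (v x) (v y) \<le> v (x + y))"

definition value_group :: "('k::field \<Rightarrow> 'g::linordered_ab_group_add extended) \<Rightarrow> 'g set" where
  "value_group v = {g. \<exists>x. x \<noteq> 0 \<and> v x = Fin g}"

section \<open>Pseudo convergent sequences\<close>

(* Sequences of limit ordinal length are indexed by a well-ordered type without greatest
   element; "sufficiently large" is the filter at_top of that type. *)

definition pseudo_convergent ::
    "('k::field \<Rightarrow> 'g::linordered_ab_group_add extended) \<Rightarrow> ('i::{wellorder,no_top} \<Rightarrow> 'k) \<Rightarrow> bool" where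
  "pseudo_convergent v z \<longleftrightarrow>
     (\<forall>\<nu>\<^sub>1 \<nu>\<^sub>2 \<nu>\<^sub>3. \<nu>\<^sub>1 < \<nu>\<^sub>2 \<and> \<nu>\<^sub>2 < \<nu>\<^sub>3 \<longrightarrow> v (z \<nu>\<^sub>1 - z \<nu>\<^sub>2) < v (z \<nu>\<^sub>2 - z \<nu>\<^sub>3))"

definition algebraic_type ::
    "('k::field \<Rightarrow> 'g::linordered_ab_group_add extended) \<Rightarrow> ('i::{wellorder,no_top} \<Rightarrow> 'k) \<Rightarrow> bool" where
  "algebraic_type v z \<longleftrightarrow>
     (\<exists>f. \<not> (\<exists>c. \<forall>\<^sub>F \<nu> in at_top. v (poly f (z \<nu>)) = c))"

definition index_zero :: "'i::wellorder" where
  "index_zero = (LEAST \<mu>. True)"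

definition index_succ :: "'i::{wellorder,no_top} \<Rightarrow> 'i" where
  "index_succ \<nu> = (LEAST \<mu>. \<nu> < \<mu>)"

(* z \<nu> and z (index_succ \<nu>) are distinct when z is pseudo convergent,
   so the described value exists. *)
definition gauge ::
    "('k::field \<Rightarrow> 'g::linordered_ab_group_add extended) \<Rightarrow> ('i::{wellorder,no_top} \<Rightarrow> 'k) \<Rightarrow> 'i \<Rightarrow> 'g" where
  "gauge v z \<nu> = (THE g. v (z \<nu> - z (index_succ \<nu>)) = Fin g)"

section \<open>The valuation of the rational function field\<close>

(* The rational function \<phi> is defined at x with value y. *)
definition evaluates_to :: "'k::field poly fract \<Rightarrow> 'k \<Rightarrow> 'k \<Rightarrow> bool" where
  "evaluates_to \<phi> x y \<longleftrightarrow>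
     (\<exists>f g. \<phi> = Fract f g \<and> poly g x \<noteq> 0 \<and> y = poly f x / poly g x)"

definition seq_ring ::
    "('k::field \<Rightarrow> 'g::linordered_ab_group_add extended) \<Rightarrow> ('i::{wellorder,no_top} \<Rightarrow> 'k) \<Rightarrow>
     'k poly fract set" where
  "seq_ring v z = {\<phi>. \<forall>\<^sub>F \<nu> in at_top. \<exists>y. evaluates_to \<phi> (z \<nu>) y \<and> 0 \<le> v y}"

(* A valuation is determined by its valuation ring only up to equivalence; w is any member of
   the equivalence class, possibly with values in another ordered group than v. *)
definition is_seq_valuation ::
    "('k::field \<Rightarrow> 'g::linordered_ab_group_add extended) \<Rightarrow> ('i::{wellorder,no_top} \<Rightarrow> 'k) \<Rightarrow>
     ('k poly fract \<Rightarrow> 'h::linordered_ab_group_add extended) \<Rightarrow> bool" where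
  "is_seq_valuation v z w \<longleftrightarrow> is_valuation w \<and> {\<phi>. 0 \<le> w \<phi>} = seq_ring v z"

end

theory Submission
  imports Defs
begin

text \<open>
  Factoring a rational function over the algebraic closure shows that its value at \<open>z \<nu>\<close> is
  \<open>\<gamma> + m \<delta> \<nu>\<close> for large \<open>\<nu>\<close>, where \<open>\<gamma>\<close> is a value of the closure and \<open>m\<close> an integer: a linear factor
  \<open>X - \<alpha>\<close> contributes \<open>\<delta> \<nu>\<close> if \<open>\<alpha>\<close> is a pseudo limit and is ultimately constant otherwise. Hence the
  value group of the rational function field consists of germs of such sequences, and the germ is
  positive iff the following vector is lexicographically positive, where \<open>s\<close> is the limit of the
  \<open>i\<close>-th components of \<open>\<delta>\<close>: for \<open>s = \<infinity>\<close> the vector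
  \<open>(\<gamma>\<^sub>j + m r\<^sub>j)\<^bsub>j<i\<^esub>, m, \<gamma>\<^sub>i, \<dots>, \<gamma>\<^sub>n\<close>; for \<open>s\<close> outside \<open>\<Gamma>\<^sub>i\<close> the vector
  \<open>(\<gamma>\<^sub>j + m r\<^sub>j)\<^bsub>j<i\<^esub>, \<gamma>\<^sub>i + m s, \<gamma>\<^bsub>i+1\<^esub>, \<dots>, \<gamma>\<^sub>n\<close>, since divisibility of \<open>\<Gamma>\<^sub>i\<close> makes \<open>\<gamma>\<^sub>i + m s = 0\<close> force
  \<open>m = 0\<close>; for an unattained \<open>s\<close> in \<open>\<Gamma>\<^sub>i\<close> the vector
  \<open>(\<gamma>\<^sub>j + m r\<^sub>j)\<^bsub>j<i\<^esub>, \<gamma>\<^sub>i + m s, -m, \<gamma>\<^bsub>i+1\<^esub>, \<dots>, \<gamma>\<^sub>n\<close>. The rank of a group embedded in a lexicographic product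
  is the number of positions at which the first nonzero component of an element can occur. All
  positions occur because values of the closure are torsion over those of \<open>v\<close> and, by algebraic type,
  some rational function has \<open>m \<noteq> 0\<close>.
\<close>

section \<open>Rank of a group embedded in a lexicographic product\<close>

text \<open>In a finite chain, counting the members strictly below a given one is an order
  isomorphism onto an initial segment of the naturals; this count is \<open>h\<close>.\<close>

lemma has_rank_card:
  assumes fin: "finite (isolated_subgroups G)"
    and chain: "\<And>A B. A \<in> isolated_subgroups G \<Longrightarrow> B \<in> isolated_subgroups G \<Longrightarrow> A \<subseteq> B \<or> B \<subseteq> A"
  shows "has_rank G (card (isolated_subgroups G))"
proof -
  define C where "C = isolated_subgroups G"
  define h where "h A = card {B\<in>C. B \<subset> A}" for A
  note fin = fin[folded C_def] and chain = chain[folded C_def]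
  have strict: "h A < h B" if "A \<in> C" "B \<in> C" "A \<subset> B" for A B
    unfolding h_def by (rule psubset_card_mono) (use fin that in auto)
  have ord: "A \<subseteq> B \<longleftrightarrow> h A \<le> h B" if "A \<in> C" "B \<in> C" for A B
    using strict[of A B] strict[of B A] chain[of A B] that by fastforce
  have "inj_on h C"
    by (rule inj_onI) (metis ord order_antisym order_refl)
  moreover have "h ` C \<subseteq> {..<card C}"
    unfolding h_def using fin by (auto intro!: psubset_card_mono)
  ultimately have "bij_betw h C {..<card C}"
    by (simp add: bij_betw_def card_image card_subset_eq)
  then show ?thesis
    unfolding has_rank_def using ord by (auto simp: C_def)
qed

lemma has_rank_unique:
  assumes "has_rank G m" "has_rank G n"
  shows "m = n"
  using assms unfolding has_rank_def by (metis bij_betw_same_card card_lessThan)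

section \<open>Leading positions and isolated subgroups\<close>

definition lex_lead :: "nat \<Rightarrow> (nat \<Rightarrow> real) \<Rightarrow> nat \<Rightarrow> bool" where
  "lex_lead n x k \<longleftrightarrow> k \<in> {1..n} \<and> (\<forall>j\<in>{1..<k}. x j = 0) \<and> x k \<noteq> 0"

lemma lex_lead_exists:
  assumes "j \<in> {1..n}" "x j \<noteq> 0"
  shows "\<exists>k\<le>j. lex_lead n x k"
proof -
  define k where "k = (LEAST k. k \<in> {1..n} \<and> x k \<noteq> 0)"
  have "k \<in> {1..n} \<and> x k \<noteq> 0"
    unfolding k_def by (rule LeastI[of _ j]) (use assms in auto)
  moreover have "x l = 0" if "l \<in> {1..<k}" for l
    using that not_less_Least[of l "\<lambda>k. k \<in> {1..n} \<and> x k \<noteq> 0"] \<open>k \<in> {1..n} \<and> x k \<noteq> 0\<close>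
    unfolding k_def[symmetric] by auto
  moreover have "k \<le> j"
    unfolding k_def by (rule Least_le) (use assms in auto)
  ultimately show ?thesis
    by (auto simp: lex_lead_def)
qed

lemma lex_less_zero_iff: "lex_less n (\<lambda>_. 0) x \<longleftrightarrow> (\<exists>k. lex_lead n x k \<and> 0 < x k)"
  unfolding lex_less_def lex_lead_def by (metis less_irrefl)

lemma lex_lead_unique: "lex_lead n x k \<Longrightarrow> lex_lead n x l \<Longrightarrow> k = l"
  unfolding lex_lead_def by (metis atLeastAtMost_iff atLeastLessThan_iff linorder_neqE_nat)

text \<open>The order of a group is determined by its positive elements, so only positivity is
  compared. The image may be a proper subgroup of the lexicographic product, as can happen for the
  value group of \<open>v\<close> inside that of the closure.\<close>

locale lex_embedding =
  fixes G :: "'g::linordered_ab_group_add set" and n :: nat and \<psi> :: "'g \<Rightarrow> nat \<Rightarrow> real"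
  assumes subgroup: "add_subgroup G"
    and add: "a \<in> G \<Longrightarrow> b \<in> G \<Longrightarrow> j \<in> {1..n} \<Longrightarrow> \<psi> (a + b) j = \<psi> a j + \<psi> b j"
    and pos: "a \<in> G \<Longrightarrow> 0 < a \<longleftrightarrow> lex_less n (\<lambda>_. 0) (\<psi> a)"
begin

lemma zero_mem: "0 \<in> G" and add_mem: "a \<in> G \<Longrightarrow> b \<in> G \<Longrightarrow> a + b \<in> G"
  and minus_mem: "a \<in> G \<Longrightarrow> - a \<in> G"
  using subgroup by (auto simp: add_subgroup_def)

lemma zero: "j \<in> {1..n} \<Longrightarrow> \<psi> 0 j = 0"
  using add[OF zero_mem zero_mem] by simp

lemma minus: "a \<in> G \<Longrightarrow> j \<in> {1..n} \<Longrightarrow> \<psi> (- a) j = - \<psi> a j"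
  using add[OF _ minus_mem, of a a j] zero by simp

lemma diff_mem: "a \<in> G \<Longrightarrow> b \<in> G \<Longrightarrow> a - b \<in> G"
  using add_mem[OF _ minus_mem, of a b] by simp

lemma diff: "a \<in> G \<Longrightarrow> b \<in> G \<Longrightarrow> j \<in> {1..n} \<Longrightarrow> \<psi> (a - b) j = \<psi> a j - \<psi> b j"
  using add[OF _ minus_mem, of a b j] minus[of b j] by simp

text \<open>A nonzero element or its negative is positive, and negation preserves leading positions.
  Hence \<open>\<psi>\<close> is injective on \<open>G\<close>.\<close>

lemma nonzero_iff: "a \<in> G \<Longrightarrow> a \<noteq> 0 \<longleftrightarrow> (\<exists>k. lex_lead n (\<psi> a) k)"
proof
  assume a: "a \<in> G" "a \<noteq> 0"
  then consider "0 < a" | "0 < - a"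
    by force
  then show "\<exists>k. lex_lead n (\<psi> a) k"
  proof cases
    case 1 then show ?thesis
      using pos[OF a(1)] by (auto simp: lex_less_zero_iff)
  next
    case 2
    then obtain k where "lex_lead n (\<psi> (- a)) k"
      using pos[OF minus_mem[OF a(1)]] by (auto simp: lex_less_zero_iff)
    then have "lex_lead n (\<psi> a) k"
      using minus[OF a(1)] by (auto simp: lex_lead_def)
    then show ?thesis ..
  qed
next
  assume "a \<in> G" "\<exists>k. lex_lead n (\<psi> a) k"
  then show "a \<noteq> 0"
    using zero by (auto simp: lex_lead_def)
qed

definition multiple :: "nat \<Rightarrow> 'g \<Rightarrow> 'g" where
  "multiple N a = (\<Sum>_<N. a)"

lemma multiple_mem: "add_subgroup D \<Longrightarrow> a \<in> D \<Longrightarrow> multiple N a \<in> D"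
  unfolding multiple_def by (induction N) (auto simp: add_subgroup_def)

lemma multiple: "a \<in> G \<Longrightarrow> j \<in> {1..n} \<Longrightarrow> \<psi> (multiple N a) j = real N * \<psi> a j"
proof (induction N)
  case (Suc N)
  then show ?case
    using add[OF multiple_mem[OF subgroup], of a a j N]
    by (simp add: multiple_def algebra_simps)
qed (simp add: multiple_def zero)

text \<open>By the Archimedean property of the reals, a multiple of \<open>x\<close> or of
  \<open>- x\<close> exceeds both \<open>g\<close> and \<open>- g\<close>, since \<open>g\<close>
  does not lead earlier than \<open>x\<close>. Convexity of \<open>D\<close> does the rest.\<close>

lemma convex_mem:
  assumes D: "add_subgroup D" "D \<subseteq> G" "\<And>a b. a \<in> D \<Longrightarrow> b \<in> G \<Longrightarrow> - a \<le> b \<Longrightarrow> b \<le> a \<Longrightarrow> b \<in> D"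
    and x: "x \<in> D" "lex_lead n (\<psi> x) l"
    and g: "g \<in> G" "lex_lead n (\<psi> g) k" "l \<le> k"
  shows "g \<in> D"
proof -
  have Dm: "- a \<in> D" if "a \<in> D" for a
    using D(1) that by (auto simp: add_subgroup_def)
  have x': "\<exists>x'\<in>D. lex_lead n (\<psi> x') l \<and> 0 < \<psi> x' l"
  proof (cases "0 < \<psi> x l")
    case False
    then show ?thesis
      using x D(2) minus[of x] Dm[OF x(1)]
      by (intro bexI[of _ "- x"]) (auto simp: lex_lead_def)
  qed (use x in auto)
  then obtain x' where x': "x' \<in> D" "x' \<in> G" "lex_lead n (\<psi> x') l" "0 < \<psi> x' l"
    using D(2) by auto
  have main: "g' \<in> D" if g': "g' \<in> G" "lex_lead n (\<psi> g') k" "0 < g'" for g'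
  proof -
    obtain N where N: "\<psi> g' l < real N * \<psi> x' l"
      using reals_Archimedean3[OF x'(4)] by metis
    have m: "multiple N x' \<in> D" "multiple N x' \<in> G"
      using multiple_mem[OF D(1) x'(1)] D(2) by auto
    \<comment> \<open>Before \<open>l\<close> both vectors vanish because \<open>l \<le> k\<close>,
      so position \<open>l\<close> decides the sign of the difference.\<close>
    have "lex_lead n (\<psi> (multiple N x' - g')) l \<and> 0 < \<psi> (multiple N x' - g') l"
      using N x' g'(2) g(3) by (auto simp: lex_lead_def diff[OF m(2) g'(1)] multiple[OF x'(2)])
    then have "0 < multiple N x' - g'"
      using pos[OF diff_mem[OF m(2) g'(1)]] by (auto simp: lex_less_zero_iff)
    then show "g' \<in> D"
      using D(3)[OF m(1) g'(1)] g'(3) by (simp add: order_trans[of _ 0])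
  qed
  have "g \<noteq> 0"
    using nonzero_iff[OF g(1)] g(2) by auto
  then consider "0 < g" | "0 < - g" by force
  then show ?thesis
  proof cases
    case 2
    have "lex_lead n (\<psi> (- g)) k"
      using g minus[OF g(1)] by (auto simp: lex_lead_def)
    then show ?thesis
      using main[of "- g"] minus_mem[OF g(1)] 2 Dm by force
  qed (use main g in auto)
qed

definition lead_set :: "nat set" where
  "lead_set = {k. \<exists>g\<in>G. lex_lead n (\<psi> g) k}"

definition tail :: "nat \<Rightarrow> 'g set" where
  "tail k = {g\<in>G. \<forall>j\<in>{1..k}. \<psi> g j = 0}"

lemma lead_set_subset: "lead_set \<subseteq> {1..n}"
  by (auto simp: lead_set_def lex_lead_def)

text \<open>If \<open>b\<close> lay between \<open>- a\<close> and \<open>a\<close> but led at a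
  position \<open>l \<le> k\<close>, then \<open>a - b\<close> and \<open>a + b\<close> would lead
  at \<open>l\<close> with opposite signs, although both are nonnegative. An element leading at
  \<open>k\<close> shows that the subgroup is proper.\<close>

lemma tail_isolated:
  assumes "k \<in> lead_set"
  shows "tail k \<in> isolated_subgroups G"
proof -
  from assms obtain g where g: "g \<in> G" "lex_lead n (\<psi> g) k"
    by (auto simp: lead_set_def)
  then have k: "k \<in> {1..n}" by (simp add: lex_lead_def)
  have "add_subgroup (tail k)"
    using k zero add minus zero_mem add_mem minus_mem
    by (auto simp: add_subgroup_def tail_def)
  moreover have "g \<notin> tail k"
    using g by (auto simp: tail_def lex_lead_def)
  moreover have "b \<in> tail k" if a: "a \<in> tail k" and b: "b \<in> G" "- a \<le> b" "b \<le> a" for a b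
  proof (rule ccontr)
    assume "b \<notin> tail k"
    then obtain j where j: "j \<in> {1..k}" "\<psi> b j \<noteq> 0"
      using b by (auto simp: tail_def)
    then have "\<exists>l\<le>j. lex_lead n (\<psi> b) l"
      using k by (intro lex_lead_exists) auto
    then obtain l where l: "lex_lead n (\<psi> b) l" "l \<le> j" by auto
    have aG: "a \<in> G" using a by (auto simp: tail_def)
    have lk: "l \<in> {1..k}" using l j by (auto simp: lex_lead_def)
    have "lex_lead n (\<psi> (a - b)) l" "lex_lead n (\<psi> (a + b)) l"
      "\<psi> (a - b) l = - \<psi> b l" "\<psi> (a + b) l = \<psi> b l"
      using l a k lk diff[OF aG b(1)] add[OF aG b(1)]
      by (auto simp: lex_lead_def tail_def)
    moreover have "0 \<le> a - b" "0 \<le> a + b"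
      using add_left_mono[OF b(2), of a] b(3) by auto
    ultimately show False
      using pos[OF diff_mem[OF aG b(1)]] pos[OF add_mem[OF aG b(1)]]
        nonzero_iff[OF diff_mem[OF aG b(1)]] nonzero_iff[OF add_mem[OF aG b(1)]]
      unfolding lex_less_zero_iff
      by (metis lex_lead_unique less_le neg_0_less_iff_less not_less_iff_gr_or_eq)
  qed
  ultimately show ?thesis
    using g(1) unfolding isolated_subgroups_def by (auto simp: tail_def)
qed

text \<open>Take for \<open>k\<close> the largest leading position of an element outside
  \<open>D\<close>. Nonzero elements of \<open>tail k\<close> lead after \<open>k\<close> and so lie
  in \<open>D\<close>; an element of \<open>D\<close> leading at \<open>k\<close> or earlier would
  by convexity force the witness \<open>h\<close> into \<open>D\<close>.\<close>

lemma isolated_tail: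
  assumes "D \<in> isolated_subgroups G"
  shows "\<exists>k\<in>lead_set. D = tail k"
proof -
  have D: "add_subgroup D" "D \<subset> G"
    "\<And>a b. a \<in> D \<Longrightarrow> b \<in> G \<Longrightarrow> - a \<le> b \<Longrightarrow> b \<le> a \<Longrightarrow> b \<in> D"
    using assms unfolding isolated_subgroups_def by auto
  have D0: "0 \<in> D" using D(1) by (simp add: add_subgroup_def)
  define S where "S = {k. \<exists>g\<in>G - D. lex_lead n (\<psi> g) k}"
  obtain g where "g \<in> G - D" using D(2) by auto
  then have "S \<noteq> {}"
    using nonzero_iff[of g] D0 by (auto simp: S_def)
  moreover have "finite S"
    by (rule finite_subset[of _ "{1..n}"]) (auto simp: S_def lex_lead_def)
  ultimately have max: "Max S \<in> S" "\<And>l. l \<in> S \<Longrightarrow> l \<le> Max S"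
    by auto
  define k where "k = Max S"
  obtain h where h: "h \<in> G" "h \<notin> D" "lex_lead n (\<psi> h) k"
    using max(1) by (auto simp: S_def k_def)
  have "tail k \<subseteq> D"
  proof
    fix x assume x: "x \<in> tail k"
    show "x \<in> D"
    proof (rule ccontr)
      assume "x \<notin> D"
      moreover from this obtain l where l: "lex_lead n (\<psi> x) l"
        using nonzero_iff[of x] D0 x by (auto simp: tail_def)
      ultimately have "l \<in> S" using x by (auto simp: S_def tail_def)
      then have "l \<in> {1..k}" using max(2) l by (auto simp: k_def lex_lead_def)
      then show False using x l by (auto simp: tail_def lex_lead_def)
    qed
  qed
  moreover have "D \<subseteq> tail k"
  proof
    fix x assume x: "x \<in> D"
    show "x \<in> tail k"
    proof (rule ccontr)
      assume "x \<notin> tail k"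
      moreover have "x \<in> G" using x D(2) by auto
      ultimately obtain j where j: "j \<in> {1..k}" "\<psi> x j \<noteq> 0"
        by (auto simp: tail_def)
      moreover have "k \<le> n" using h(3) by (simp add: lex_lead_def)
      ultimately have "\<exists>l\<le>j. lex_lead n (\<psi> x) l"
        by (intro lex_lead_exists) auto
      then obtain l where "lex_lead n (\<psi> x) l" "l \<le> k"
        using j(1) by auto
      then show False
        using convex_mem[OF D(1) psubset_imp_subset[OF D(2)] D(3) x _ h(1,3)] h(2) by simp
    qed
  qed
  ultimately show ?thesis
    using h by (auto simp: lead_set_def)
qed

lemma tail_strict:
  assumes "k \<in> lead_set" "l \<in> lead_set" "k < l"
  shows "tail l \<subset> tail k"
proof -
  obtain g where "g \<in> G" "lex_lead n (\<psi> g) l"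
    using assms(2) by (auto simp: lead_set_def)
  then have "g \<in> tail k" "g \<notin> tail l"
    using assms(3) by (auto simp: tail_def lex_lead_def)
  moreover have "tail l \<subseteq> tail k" using assms(3) by (auto simp: tail_def)
  ultimately show ?thesis by auto
qed

text \<open>The map \<open>tail\<close> is an order-reversing bijection from the leading positions
  to the isolated subgroups, which therefore form a finite chain.\<close>

lemma has_rank_lead_set: "has_rank G (card lead_set)"
proof -
  have iso: "isolated_subgroups G = tail ` lead_set"
    using tail_isolated isolated_tail by auto
  have fin: "finite lead_set"
    using lead_set_subset finite_subset by blast
  have "inj_on tail lead_set"
    by (rule inj_onI) (metis linorder_neqE_nat order_less_irrefl tail_strict)
  then have "card (isolated_subgroups G) = card lead_set"
    by (simp add: iso card_image)
  moreover have "has_rank G (card (isolated_subgroups G))"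
  proof (rule has_rank_card)
    show "finite (isolated_subgroups G)" using fin iso by simp
    fix A B assume "A \<in> isolated_subgroups G" "B \<in> isolated_subgroups G"
    then obtain k l where "A = tail k" "B = tail l" by (auto simp: iso)
    then show "A \<subseteq> B \<or> B \<subseteq> A"
      by (cases "k \<le> l") (auto simp: tail_def)
  qed
  ultimately show ?thesis by simp
qed

lemma has_rank_if_all_lead:
  assumes "\<And>k. k \<in> {1..n} \<Longrightarrow> \<exists>g\<in>G. lex_lead n (\<psi> g) k"
  shows "has_rank G n"
proof -
  have "lead_set = {1..n}"
    using lead_set_subset assms by (auto simp: lead_set_def)
  then show ?thesis using has_rank_lead_set by simp
qed

text \<open>The leading positions form a subset of \<open>{1..n}\<close> with \<open>n\<close>
  elements. Applied to the value group of \<open>v\<close>, this turns the hypothesis on its rank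
  into a supply of elements.\<close>

lemma all_lead_if_has_rank:
  assumes "has_rank G n" "k \<in> {1..n}"
  shows "\<exists>g\<in>G. lex_lead n (\<psi> g) k"
proof -
  have "card lead_set = card {1..n}"
    using has_rank_unique[OF has_rank_lead_set assms(1)] by simp
  then have "lead_set = {1..n}"
    using lead_set_subset card_subset_eq by blast
  then show ?thesis using assms(2) by (auto simp: lead_set_def)
qed

end

section \<open>Valuations and pseudo convergent sequences\<close>

text \<open>Lets values be computed in the group itself; the result is unspecified at elements of
  infinite value.\<close>

definition fin_val :: "('k::field \<Rightarrow> 'g::linordered_ab_group_add extended) \<Rightarrow> 'k \<Rightarrow> 'g" where
  "fin_val v x = (THE g. v x = Fin g)"

lemma gauge_eq_fin_val: "gauge v z \<nu> = fin_val v (z \<nu> - z (index_succ \<nu>))"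
  by (simp add: gauge_def fin_val_def)

locale valued =
  fixes v :: "'k::field \<Rightarrow> 'g::linordered_ab_group_add extended"
  assumes valuation: "is_valuation v"
begin

abbreviation val :: "'k \<Rightarrow> 'g" where "val \<equiv> fin_val v"

lemma v_0 [simp]: "v 0 = Pinf"
  and v_eq_Pinf_iff: "v x = Pinf \<longleftrightarrow> x = 0"
  and v_neq_Minf: "v x \<noteq> Minf"
  and v_mult: "v (x * y) = v x + v y"
  and v_add: "min (v x) (v y) \<le> v (x + y)"
  using valuation by (auto simp: is_valuation_def)

lemma v_eq_Fin: "x \<noteq> 0 \<Longrightarrow> v x = Fin (val x)"
  using v_eq_Pinf_iff[of x] v_neq_Minf[of x] by (cases "v x") (auto simp: fin_val_def)

lemma val_eqI: "v x = Fin g \<Longrightarrow> val x = g"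
  by (simp add: fin_val_def)

lemma val_mult: "x \<noteq> 0 \<Longrightarrow> y \<noteq> 0 \<Longrightarrow> val (x * y) = val x + val y"
  using v_mult[of x y] by (simp add: v_eq_Fin)

lemma val_1: "val 1 = 0"
  using val_mult[of 1 1] by simp

lemma val_inverse: "x \<noteq> 0 \<Longrightarrow> val (inverse x) = - val x"
  using val_mult[of x "inverse x"] by (simp add: val_1 eq_neg_iff_add_eq_0 add.commute)

lemma v_minus [simp]: "v (- x) = v x"
proof -
  have "val (-1) + val (-1) = 0"
    using val_mult[of "-1" "-1"] by (simp add: val_1)
  then have "v (-1) = 0"
    by (simp add: v_eq_Fin zero_extended_def)
  then show ?thesis
    using v_mult[of "-1" x] by simp
qed

lemma v_diff_commute: "v (x - y) = v (y - x)"
  using v_minus[of "x - y"] by simp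

text \<open>Were \<open>v (x + y)\<close> larger than \<open>v x\<close>, then
  \<open>x = (x + y) - y\<close> would be a sum of two elements of larger value.\<close>

lemma v_add_eq:
  assumes "v x < v y"
  shows "v (x + y) = v x"
  using v_add[of x y] v_add[of "x + y" "- y"] assms by (auto simp: min_def split: if_splits)

lemma v_sum_greater:
  assumes "finite A" "a < Pinf" "\<And>i. i \<in> A \<Longrightarrow> a < v (t i)"
  shows "a < v (\<Sum>i\<in>A. t i)"
  using assms(1,3)
proof (induction A rule: finite_induct)
  case (insert i A)
  then have "a < min (v (t i)) (v (\<Sum>i\<in>A. t i))" by simp
  then show ?case
    using less_le_trans[OF _ v_add] insert.hyps by simp
qed (use assms(2) in simp)

text \<open>If a term of least value were the only one with that value, it would equal minus a sum
  of strictly larger value.\<close>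

lemma sum_eq_0_imp_same_value:
  assumes A: "finite A" and sum: "(\<Sum>i\<in>A. t i) = 0" and nz: "i0 \<in> A" "t i0 \<noteq> 0"
  obtains i j where "i \<in> A" "j \<in> A" "i \<noteq> j" "t i \<noteq> 0" "t j \<noteq> 0" "v (t i) = v (t j)"
proof -
  define i where "i = arg_min_on (\<lambda>i. v (t i)) A"
  have i: "i \<in> A" "\<And>j. j \<in> A \<Longrightarrow> v (t i) \<le> v (t j)"
    unfolding i_def using arg_min_if_finite[OF A, of "\<lambda>i. v (t i)"] nz(1) by (auto simp: not_less)
  have fin: "v (t i) < Pinf"
    using i(2)[OF nz(1)] nz(2) by (simp add: v_eq_Fin le_less_trans[of _ "Fin (val (t i0))"])
  have "\<exists>j\<in>A - {i}. v (t j) = v (t i)"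
  proof (rule ccontr)
    assume "\<not> ?thesis"
    then have "v (t i) < v (t j)" if "j \<in> A - {i}" for j
      using i(2)[of j] that by fastforce
    then have less: "v (t i) < v (\<Sum>j\<in>A - {i}. t j)"
      using v_sum_greater[of "A - {i}" "v (t i)" t] A fin by auto
    have "t i + (\<Sum>j\<in>A - {i}. t j) = 0"
      using sum sum.remove[OF A i(1), of t] by simp
    then have "t i = - (\<Sum>j\<in>A - {i}. t j)"
      by (simp add: eq_neg_iff_add_eq_0)
    then show False using less by simp
  qed
  then obtain j where "j \<in> A" "j \<noteq> i" "v (t j) = v (t i)" by auto
  moreover from this have "t i \<noteq> 0" "t j \<noteq> 0" using fin by force+
  ultimately show thesis using that i(1) by metis
qed

lemma val_mem: "x \<noteq> 0 \<Longrightarrow> val x \<in> value_group v"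
  unfolding value_group_def using v_eq_Fin by blast

lemma value_groupE:
  assumes "g \<in> value_group v"
  obtains x where "x \<noteq> 0" "val x = g"
  using assms unfolding value_group_def using val_eqI by blast

lemma subgroup_value_group: "add_subgroup (value_group v)"
  unfolding add_subgroup_def
proof (intro conjI ballI)
  show "0 \<in> value_group v" using val_mem[of 1] by (simp add: val_1)
next
  fix a b assume "a \<in> value_group v" "b \<in> value_group v"
  then show "a + b \<in> value_group v"
    by (metis value_groupE val_mem val_mult mult_eq_0_iff)
next
  fix a assume "a \<in> value_group v"
  then show "- a \<in> value_group v"
    by (metis value_groupE val_mem val_inverse inverse_zero_imp_zero)
qed

end

section \<open>Pseudo convergent sequences and their gauge\<close>

lemma less_index_succ: "\<nu> < index_succ (\<nu>::'i::{wellorder,no_top})"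
  unfolding index_succ_def using gt_ex by (rule LeastI_ex)

lemma index_succ_le: "\<nu> < \<mu> \<Longrightarrow> index_succ (\<nu>::'i::{wellorder,no_top}) \<le> \<mu>"
  unfolding index_succ_def by (rule Least_le)

locale pseudo_convergent_sequence = valued v
  for v :: "'k::field \<Rightarrow> 'g::linordered_ab_group_add extended" +
  fixes z :: "'i::{wellorder,no_top} \<Rightarrow> 'k"
  assumes pseudo_convergent: "pseudo_convergent v z"
begin

lemma v_diff_less: "\<nu>\<^sub>1 < \<nu>\<^sub>2 \<Longrightarrow> \<nu>\<^sub>2 < \<nu>\<^sub>3 \<Longrightarrow> v (z \<nu>\<^sub>1 - z \<nu>\<^sub>2) < v (z \<nu>\<^sub>2 - z \<nu>\<^sub>3)"
  using pseudo_convergent by (auto simp: pseudo_convergent_def)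

lemma neq: "\<nu> < \<mu> \<Longrightarrow> z \<nu> \<noteq> z \<mu>"
  using v_diff_less[of \<nu> \<mu> "index_succ \<mu>"] less_index_succ[of \<mu>] by auto

lemma gauge_mem: "gauge v z \<nu> \<in> value_group v"
  unfolding gauge_eq_fin_val using neq[OF less_index_succ] by (intro val_mem) simp

text \<open>Passing from the successor of \<open>\<nu>\<close> to a later \<open>\<mu>\<close>
  changes the difference by a term of larger value only.\<close>

lemma v_diff:
  assumes "\<nu> < \<mu>"
  shows "v (z \<nu> - z \<mu>) = Fin (gauge v z \<nu>)"
proof -
  let ?s = "index_succ \<nu>"
  have s: "v (z \<nu> - z ?s) = Fin (gauge v z \<nu>)"
    unfolding gauge_eq_fin_val using neq[OF less_index_succ] by (intro v_eq_Fin) simp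
  show ?thesis
  proof (cases "?s = \<mu>")
    case False
    then have "?s < \<mu>" using index_succ_le[OF assms] by simp
    then show ?thesis
      using v_add_eq[OF v_diff_less[OF less_index_succ, of \<nu> \<mu>]] s by simp
  qed (use s in simp)
qed

lemma gauge_strict_mono: "\<nu> < \<mu> \<Longrightarrow> gauge v z \<nu> < gauge v z \<mu>"
  using v_diff_less[of \<nu> \<mu> "index_succ \<mu>"] less_index_succ[of \<mu>] by (simp add: v_diff)

text \<open>If \<open>z \<nu> - \<alpha>\<close> once has value below the gauge, later steps are too
  small to change it. Otherwise \<open>\<alpha>\<close> is a pseudo limit: a value above the gauge
  at \<open>\<nu>\<close> would give, at the successor, the gauge of \<open>\<nu>\<close>, which is
  below the gauge there.\<close>

lemma v_diff_eventually:
  "(\<forall>\<nu>. v (z \<nu> - \<alpha>) = Fin (gauge v z \<nu>)) \<or>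
   (\<exists>g\<in>value_group v. \<forall>\<^sub>F \<nu> in at_top. v (z \<nu> - \<alpha>) = Fin g)"
proof (cases "\<exists>\<nu>. v (z \<nu> - \<alpha>) < Fin (gauge v z \<nu>)")
  case True
  then obtain \<nu> where \<nu>: "v (z \<nu> - \<alpha>) < Fin (gauge v z \<nu>)" ..
  then have nz: "z \<nu> - \<alpha> \<noteq> 0" by auto
  have "v (z \<mu> - \<alpha>) = v (z \<nu> - \<alpha>)" if "\<nu> < \<mu>" for \<mu>
    using v_add_eq[of "z \<nu> - \<alpha>" "z \<mu> - z \<nu>"] \<nu> v_diff[OF that] v_diff_commute[of "z \<mu>" "z \<nu>"]
    by simp
  then have "\<forall>\<^sub>F \<mu> in at_top. v (z \<mu> - \<alpha>) = Fin (val (z \<nu> - \<alpha>))"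
    using eventually_mono[OF eventually_gt_at_top[of \<nu>]] v_eq_Fin[OF nz] by simp
  then show ?thesis using val_mem[OF nz] by blast
next
  case False
  have "v (z \<nu> - \<alpha>) = Fin (gauge v z \<nu>)" for \<nu>
  proof (rule ccontr)
    assume "v (z \<nu> - \<alpha>) \<noteq> Fin (gauge v z \<nu>)"
    with False have greater: "Fin (gauge v z \<nu>) < v (z \<nu> - \<alpha>)" by (metis linorder_neqE)
    let ?\<mu> = "index_succ \<nu>"
    have d: "v (z ?\<mu> - z \<nu>) = Fin (gauge v z \<nu>)"
      using v_diff[OF less_index_succ] v_diff_commute by metis
    then have "v (z ?\<mu> - \<alpha>) = Fin (gauge v z \<nu>)"
      using v_add_eq[of "z ?\<mu> - z \<nu>" "z \<nu> - \<alpha>"] greater by simp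
    then show False
      using False gauge_strict_mono[OF less_index_succ[of \<nu>]] by (metis less_extended_simps(1))
  qed
  then show ?thesis by blast
qed

end

section \<open>Values of rational functions along the sequence\<close>

text \<open>Components are controlled only on \<open>{1..n}\<close>; this allows replacing vectors
  that agree there.\<close>

lemma lex_less_cong:
  "(\<And>j. j \<in> {1..n} \<Longrightarrow> x j = x' j) \<Longrightarrow> (\<And>j. j \<in> {1..n} \<Longrightarrow> y j = y' j) \<Longrightarrow>
   lex_less n x y \<longleftrightarrow> lex_less n x' y'"
  unfolding lex_less_def by (intro bex_cong refl conj_cong ball_cong) auto

section \<open>Componentwise values of polynomials over an algebraically closed field\<close>

text \<open>Meant for the extension of \<open>v\<close> to the closure, whose value group carries
  the identification \<open>c\<close>; values of \<open>v\<close> are read through the inclusion of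
  value groups.\<close>

locale lex_valued = valued u
  for u :: "'k::field \<Rightarrow> 'g::linordered_ab_group_add extended" +
  fixes n :: nat and \<Gamma> :: "nat \<Rightarrow> real set" and c :: "'g \<Rightarrow> nat \<Rightarrow> real"
  assumes \<Gamma>: "\<And>j. j \<in> {1..n} \<Longrightarrow> add_subgroup (\<Gamma> j)"
    and lex: "lex_identification (value_group u) n \<Gamma> c"
begin

lemma c_add: "a \<in> value_group u \<Longrightarrow> b \<in> value_group u \<Longrightarrow> j \<in> {1..n} \<Longrightarrow> c (a + b) j = c a j + c b j"
  and c_less: "a \<in> value_group u \<Longrightarrow> b \<in> value_group u \<Longrightarrow> a < b \<longleftrightarrow> lex_less n (c a) (c b)"
  and c_bij: "bij_betw c (value_group u) (\<Pi>\<^sub>E i\<in>{1..n}. \<Gamma> i)"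
  using lex by (auto simp: lex_identification_def)

lemma zero_mem_value_group: "0 \<in> value_group u"
  using subgroup_value_group by (simp add: add_subgroup_def)

lemma c_0: "j \<in> {1..n} \<Longrightarrow> c 0 j = 0"
  using c_add[OF zero_mem_value_group zero_mem_value_group] by simp

lemma lex_embedding_subgroup:
  assumes "add_subgroup H" "H \<subseteq> value_group u"
  shows "lex_embedding H n c"
proof
  fix a assume "a \<in> H"
  then have "0 < a \<longleftrightarrow> lex_less n (c 0) (c a)"
    using c_less[OF zero_mem_value_group] assms(2) by auto
  also have "\<dots> \<longleftrightarrow> lex_less n (\<lambda>_. 0) (c a)"
    by (rule lex_less_cong) (auto simp: c_0)
  finally show "0 < a \<longleftrightarrow> lex_less n (\<lambda>_. 0) (c a)" .
qed (use assms(1) c_add[OF subsetD[OF assms(2)] subsetD[OF assms(2)]] in simp_all)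

lemma c_mem: "g \<in> value_group u \<Longrightarrow> j \<in> {1..n} \<Longrightarrow> c g j \<in> \<Gamma> j"
  using bij_betwE[OF c_bij] by (auto simp: PiE_iff)

lemma c_inj:
  assumes "a \<in> value_group u" "b \<in> value_group u" "\<And>j. j \<in> {1..n} \<Longrightarrow> c a j = c b j"
  shows "a = b"
proof -
  have "c a \<in> (\<Pi>\<^sub>E i\<in>{1..n}. \<Gamma> i)" "c b \<in> (\<Pi>\<^sub>E i\<in>{1..n}. \<Gamma> i)"
    using bij_betwE[OF c_bij] assms(1,2) by auto
  then have "c a = c b"
    using assms(3) by (rule PiE_ext)
  then show ?thesis
    using c_bij assms(1,2) by (auto simp: bij_betw_def inj_on_def)
qed

lemma c_surj:
  assumes "\<And>j. j \<in> {1..n} \<Longrightarrow> \<gamma> j \<in> \<Gamma> j"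
  obtains x where "x \<noteq> 0" "\<And>j. j \<in> {1..n} \<Longrightarrow> c (val x) j = \<gamma> j"
proof -
  have "restrict \<gamma> {1..n} \<in> (\<Pi>\<^sub>E i\<in>{1..n}. \<Gamma> i)"
    using assms by auto
  then obtain g where g: "g \<in> value_group u" "c g = restrict \<gamma> {1..n}"
    using c_bij unfolding bij_betw_def by (metis imageE)
  then show thesis
    by (metis that value_groupE restrict_apply')
qed

lemma \<Gamma>_0: "j \<in> {1..n} \<Longrightarrow> 0 \<in> \<Gamma> j"
  and \<Gamma>_add: "j \<in> {1..n} \<Longrightarrow> a \<in> \<Gamma> j \<Longrightarrow> b \<in> \<Gamma> j \<Longrightarrow> a + b \<in> \<Gamma> j"
  and \<Gamma>_minus: "j \<in> {1..n} \<Longrightarrow> a \<in> \<Gamma> j \<Longrightarrow> - a \<in> \<Gamma> j"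
  using \<Gamma> by (auto simp: add_subgroup_def)

lemma c_val_mult: "x \<noteq> 0 \<Longrightarrow> y \<noteq> 0 \<Longrightarrow> j \<in> {1..n} \<Longrightarrow> c (val (x * y)) j = c (val x) j + c (val y) j"
  by (simp add: val_mult c_add val_mem)

lemma c_val_inverse: "x \<noteq> 0 \<Longrightarrow> j \<in> {1..n} \<Longrightarrow> c (val (inverse x)) j = - c (val x) j"
  using c_val_mult[of x "inverse x" j] by (simp add: val_1 c_0)

lemma c_val_power: "x \<noteq> 0 \<Longrightarrow> j \<in> {1..n} \<Longrightarrow> c (val (x ^ N)) j = real N * c (val x) j"
  by (induction N) (simp_all add: val_1 c_0 c_val_mult algebra_simps)

end

text \<open>Induction on the degree, splitting off one root at a time. The number \<open>m\<close>
  counts, with multiplicity, the roots that are pseudo limits; \<open>\<gamma>\<close> collects the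
  value of the constant factor and those of the other linear factors.\<close>

lemma (in lex_valued) poly_value_eventually:
  fixes z :: "'i::{wellorder,no_top} \<Rightarrow> 'k"
  assumes z: "pseudo_convergent u z"
    and roots: "\<And>p :: 'k poly. degree p > 0 \<Longrightarrow> \<exists>x. poly p x = 0"
    and p: "p \<noteq> 0"
  shows "\<exists>\<gamma> m. (\<forall>j\<in>{1..n}. \<gamma> j \<in> \<Gamma> j) \<and>
     (\<forall>\<^sub>F \<nu> in at_top. poly p (z \<nu>) \<noteq> 0 \<and>
        (\<forall>j\<in>{1..n}. c (val (poly p (z \<nu>))) j = \<gamma> j + real m * c (gauge u z \<nu>) j))"
  using p
proof (induction "degree p" arbitrary: p)
  case 0
  then obtain a where a: "p = [:a:]" "a \<noteq> 0"
    by (metis degree_eq_zeroE pCons_0_0)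
  then show ?case
    using c_mem[OF val_mem[OF a(2)]] by (intro exI[of _ "c (val a)"] exI[of _ 0]) auto
next
  case (Suc d)
  interpret pseudo_convergent_sequence u z
    by standard (fact z)
  obtain \<alpha> where "poly p \<alpha> = 0"
    using roots[of p] Suc.hyps(2) by auto
  then obtain q where pq: "p = [:-\<alpha>, 1:] * q"
    by (auto simp: poly_eq_0_iff_dvd elim: dvdE)
  with Suc.prems have q: "q \<noteq> 0" by auto
  then have "degree p = Suc (degree q)"
    unfolding pq by (subst degree_mult_eq) auto
  with Suc.hyps(2) have "d = degree q" by simp
  from Suc.hyps(1)[OF this q] obtain \<gamma> m where \<gamma>: "\<forall>j\<in>{1..n}. \<gamma> j \<in> \<Gamma> j"
    and m: "\<forall>\<^sub>F \<nu> in at_top. poly q (z \<nu>) \<noteq> 0 \<and>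
        (\<forall>j\<in>{1..n}. c (val (poly q (z \<nu>))) j = \<gamma> j + real m * c (gauge u z \<nu>) j)"
    by blast
  \<comment> \<open>The value \<open>g\<close> of the linear factor is left open: it is the gauge if
    \<open>\<alpha>\<close> is a pseudo limit and a fixed value otherwise.\<close>
  have step: "poly p (z \<nu>) \<noteq> 0 \<and>
      (\<forall>j\<in>{1..n}. c (val (poly p (z \<nu>))) j = c g j + \<gamma> j + real m * c (gauge u z \<nu>) j)"
    if "poly q (z \<nu>) \<noteq> 0 \<and>
        (\<forall>j\<in>{1..n}. c (val (poly q (z \<nu>))) j = \<gamma> j + real m * c (gauge u z \<nu>) j)"
      "u (z \<nu> - \<alpha>) = Fin g" for \<nu> g
  proof -
    have "z \<nu> - \<alpha> \<noteq> 0" using that(2) by force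
    moreover have "poly p (z \<nu>) = (z \<nu> - \<alpha>) * poly q (z \<nu>)"
      by (simp add: pq left_diff_distrib)
    ultimately show ?thesis
      using that by (auto simp: c_val_mult val_eqI)
  qed
  from v_diff_eventually[of \<alpha>] show ?case
  proof
    assume *: "\<forall>\<nu>. u (z \<nu> - \<alpha>) = Fin (gauge u z \<nu>)"
    show ?case
      by (intro exI[of _ \<gamma>] exI[of _ "Suc m"] conjI \<gamma> eventually_mono[OF m])
        (use * step in \<open>auto simp: algebra_simps\<close>)
  next
    assume "\<exists>g\<in>value_group u. \<forall>\<^sub>F \<nu> in at_top. u (z \<nu> - \<alpha>) = Fin g"
    then obtain g where g: "g \<in> value_group u" "\<forall>\<^sub>F \<nu> in at_top. u (z \<nu> - \<alpha>) = Fin g" by auto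
    show ?case
      by (intro exI[of _ "\<lambda>j. c g j + \<gamma> j"] exI[of _ m] conjI
            eventually_mono[OF eventually_conj[OF m g(2)]])
        (use step \<gamma> g(1) in \<open>auto simp: \<Gamma>_add c_mem\<close>)
  qed
qed

section \<open>Evaluation of rational functions\<close>

text \<open>Equality of fractions is a polynomial identity, which can be evaluated at
  \<open>x\<close>.\<close>

lemma evaluates_to_unique:
  assumes "evaluates_to \<phi> x y" "evaluates_to \<phi> x y'"
  shows "y = y'"
proof -
  obtain f g f' g' where *: "\<phi> = Fract f g" "poly g x \<noteq> 0" "y = poly f x / poly g x"
      "\<phi> = Fract f' g'" "poly g' x \<noteq> 0" "y' = poly f' x / poly g' x"
    using assms unfolding evaluates_to_def by metis
  then have "f * g' = f' * g"
    using eq_fract(1)[of g g' f f'] by (metis poly_0)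
  then have "poly f x * poly g' x = poly f' x * poly g x"
    by (metis poly_mult)
  then show ?thesis using * by (simp add: frac_eq_eq)
qed

lemma evaluates_to_mult:
  assumes "evaluates_to \<phi> x y" "evaluates_to \<phi>' x y'"
  shows "evaluates_to (\<phi> * \<phi>') x (y * y')"
proof -
  obtain f g f' g' where "\<phi> = Fract f g" "poly g x \<noteq> 0" "y = poly f x / poly g x"
      "\<phi>' = Fract f' g'" "poly g' x \<noteq> 0" "y' = poly f' x / poly g' x"
    using assms unfolding evaluates_to_def by metis
  then show ?thesis
    unfolding evaluates_to_def by (intro exI[of _ "f * f'"] exI[of _ "g * g'"]) simp
qed

lemma evaluates_to_inverse:
  assumes "evaluates_to \<phi> x y" "y \<noteq> 0"
  shows "evaluates_to (inverse \<phi>) x (inverse y)"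
proof -
  obtain f g where "\<phi> = Fract f g" "poly g x \<noteq> 0" "y = poly f x / poly g x"
    using assms unfolding evaluates_to_def by metis
  with assms(2) show ?thesis
    unfolding evaluates_to_def by (intro exI[of _ g] exI[of _ f]) simp
qed

section \<open>Values in the closure compared with values in the base field\<close>

locale algebraic_sequence =
  K: pseudo_convergent_sequence v z + L: lex_valued vbar n \<Gamma> c
  for v :: "'k::field \<Rightarrow> 'g::linordered_ab_group_add extended"
    and z :: "'i::{wellorder,no_top} \<Rightarrow> 'k"
    and vbar :: "'k alg_closure \<Rightarrow> 'g extended" and n \<Gamma> c +
  assumes extends: "vbar (to_ac x) = v x"
    and algebraic: "algebraic_type v z"
begin

abbreviation val :: "'k \<Rightarrow> 'g" where "val \<equiv> fin_val v"

definition \<delta> :: "nat \<Rightarrow> 'i \<Rightarrow> real" where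
  "\<delta> j \<nu> = c (gauge v z \<nu>) j"

lemma val_to_ac: "L.val (to_ac x) = val x"
  by (simp add: fin_val_def extends)

lemma gauge_to_ac: "gauge vbar (\<lambda>\<nu>. to_ac (z \<nu>)) = gauge v z"
  by (simp add: fun_eq_iff gauge_def extends flip: to_ac_diff)

lemma value_group_subset: "value_group v \<subseteq> value_group vbar"
proof
  fix g assume "g \<in> value_group v"
  then obtain x where "x \<noteq> 0" "v x = Fin g" by (auto simp: value_group_def)
  then have "to_ac x \<noteq> 0" "vbar (to_ac x) = Fin g" by (simp_all add: extends)
  then show "g \<in> value_group vbar" unfolding value_group_def by blast
qed

lemma val_mem: "x \<noteq> 0 \<Longrightarrow> val x \<in> value_group vbar"
  using value_group_subset K.val_mem by auto

lemma lex_embedding: "lex_embedding (value_group v) n c"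
  by (rule L.lex_embedding_subgroup[OF K.subgroup_value_group value_group_subset])

lemma c_val_mult: "x \<noteq> 0 \<Longrightarrow> y \<noteq> 0 \<Longrightarrow> j \<in> {1..n} \<Longrightarrow> c (val (x * y)) j = c (val x) j + c (val y) j"
  using L.c_val_mult[of "to_ac x" "to_ac y"] by (simp add: val_to_ac flip: to_ac_mult)

lemma c_val_inverse: "x \<noteq> 0 \<Longrightarrow> j \<in> {1..n} \<Longrightarrow> c (val (inverse x)) j = - c (val x) j"
  using L.c_val_inverse[of "to_ac x"] by (simp add: val_to_ac flip: to_ac_inverse)

text \<open>The closure contains an \<open>N\<close>-th root of an element whose value has component
  \<open>s\<close> at \<open>i\<close> and 0 elsewhere.\<close>

lemma \<Gamma>_divisible:
  assumes i: "i \<in> {1..n}" and s: "s \<in> \<Gamma> i" and N: "N > 0"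
  shows "s / real N \<in> \<Gamma> i"
proof -
  have "(if j = i then s else 0) \<in> \<Gamma> j" if "j \<in> {1..n}" for j
    using s L.\<Gamma>_0[OF that] by simp
  then obtain y where y: "y \<noteq> 0" "\<And>j. j \<in> {1..n} \<Longrightarrow> c (L.val y) j = (if j = i then s else 0)"
    using L.c_surj[of "\<lambda>j. if j = i then s else 0"] by blast
  obtain x where x: "x ^ N = y"
    using nth_root_exists[OF N] by blast
  then have "x \<noteq> 0" using y(1) N by auto
  then have "c (L.val x) i = s / real N"
    using L.c_val_power[of x i N] x y(2)[OF i] i N by (simp add: field_simps)
  then show ?thesis
    using L.c_mem[OF L.val_mem[OF \<open>x \<noteq> 0\<close>] i] by simp
qed

lemma not_in_\<Gamma>_multiple:
  assumes i: "i \<in> {1..n}" and s: "s \<notin> \<Gamma> i" and g: "g \<in> \<Gamma> i" "g + of_int m * s = 0"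
  shows "m = 0"
proof (rule ccontr)
  assume m: "m \<noteq> 0"
  \<comment> \<open>Since \<open>s = - g / m\<close>, the sign of \<open>m\<close> is moved to the
    numerator so that the divisor becomes a positive natural number.\<close>
  have "(if m > 0 then - g else g) \<in> \<Gamma> i"
    using g(1) L.\<Gamma>_minus[OF i] by simp
  from \<Gamma>_divisible[OF i this, of "nat \<bar>m\<bar>"] have "(if m > 0 then - g else g) / real (nat \<bar>m\<bar>) \<in> \<Gamma> i"
    using m by simp
  also have "(if m > 0 then - g else g) / real (nat \<bar>m\<bar>) = s"
    using g(2) m by (auto simp: field_simps)
  finally show False using s by simp
qed

text \<open>Comparing two terms of equal value in a polynomial relation for \<open>y\<close>.\<close>
lemma value_torsion:
  fixes y :: "'k alg_closure"
  assumes y: "y \<noteq> 0"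
  obtains x N where "x \<noteq> 0" "N > 0" "\<And>j. j \<in> {1..n} \<Longrightarrow> c (val x) j = real N * c (L.val y) j"
proof -
  obtain p :: "'k poly" where p: "p \<noteq> 0" "poly (map_poly to_ac p) y = 0"
    using alg_closure_algebraic by blast
  define t where "t i = to_ac (coeff p i) * y ^ i" for i
  have sum: "(\<Sum>i\<le>degree p. t i) = 0"
    using p(2) by (simp add: poly_altdef t_def coeff_map_poly degree_map_poly)
  have lead: "degree p \<in> {..degree p}" "t (degree p) \<noteq> 0"
    using p(1) y by (simp_all add: t_def)
  obtain i j where ij: "i \<noteq> j" "t i \<noteq> 0" "t j \<noteq> 0" "vbar (t i) = vbar (t j)"
    using L.sum_eq_0_imp_same_value[OF finite_atMost sum lead] by blast
  note result = that
  \<comment> \<open>The two terms enter symmetrically. With \<open>i < j\<close> and coefficients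
    a_i, a_j, equal values of the terms say that a_i / a_j has value \<open>j - i\<close> times that
    of \<open>y\<close>.\<close>
  have main: thesis if ij: "i < j" "t i \<noteq> 0" "t j \<noteq> 0" "vbar (t i) = vbar (t j)" for i j
  proof -
    have nz: "coeff p i \<noteq> 0" "coeff p j \<noteq> 0" using ij by (auto simp: t_def)
    have "c (val (coeff p i / coeff p j)) k = real (j - i) * c (L.val y) k" if k: "k \<in> {1..n}" for k
    proof -
      have "c (L.val (t l)) k = c (val (coeff p l)) k + real l * c (L.val y) k" if "t l \<noteq> 0" for l
        using that y k by (auto simp: t_def L.c_val_mult L.c_val_power val_to_ac)
      moreover have "L.val (t i) = L.val (t j)"
        using ij(4) by (simp add: fin_val_def)
      ultimately have "c (val (coeff p i)) k + real i * c (L.val y) k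
          = c (val (coeff p j)) k + real j * c (L.val y) k"
        using ij(2,3) by metis
      moreover have "c (val (coeff p i / coeff p j)) k = c (val (coeff p i)) k - c (val (coeff p j)) k"
        using nz k by (simp add: field_class.field_divide_inverse c_val_mult c_val_inverse)
      ultimately show ?thesis
        using ij(1) by (simp add: of_nat_diff algebra_simps)
    qed
    then show thesis
      using result[of "coeff p i / coeff p j" "j - i"] nz ij(1) by simp
  qed
  show thesis
    using main[OF _ ij(2,3,4)] main[OF _ ij(3,2) ij(4)[symmetric]] ij(1) by (metis linorder_neqE_nat)
qed

section \<open>Representing values along the sequence by pairs\<close>

text \<open>The number \<open>m\<close> is an integer because poles at pseudo limits count
  negatively; \<open>\<gamma>\<close> matters only on \<open>{1..n}\<close>. The existential also
  records that the function is ultimately defined and nonzero along the sequence.\<close>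

definition rep :: "'k poly fract \<Rightarrow> (nat \<Rightarrow> real) \<Rightarrow> int \<Rightarrow> bool" where
  "rep \<phi> \<gamma> m \<longleftrightarrow> (\<forall>j\<in>{1..n}. \<gamma> j \<in> \<Gamma> j) \<and>
     (\<forall>\<^sub>F \<nu> in at_top. \<exists>y. evaluates_to \<phi> (z \<nu>) y \<and> y \<noteq> 0 \<and>
        (\<forall>j\<in>{1..n}. c (val y) j = \<gamma> j + of_int m * \<delta> j \<nu>))"

lemma rep_cong:
  assumes "rep \<phi> \<gamma> m" "\<And>j. j \<in> {1..n} \<Longrightarrow> \<gamma> j = \<gamma>' j" "m = m'"
  shows "rep \<phi> \<gamma>' m'"
  using assms by (simp add: rep_def)

lemma rep_mult:
  assumes "rep \<phi> \<gamma> m" "rep \<phi>' \<gamma>' m'"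
  shows "rep (\<phi> * \<phi>') (\<lambda>j. \<gamma> j + \<gamma>' j) (m + m')"
  unfolding rep_def
proof (intro conjI)
  show "\<forall>\<^sub>F \<nu> in at_top. \<exists>y. evaluates_to (\<phi> * \<phi>') (z \<nu>) y \<and> y \<noteq> 0 \<and>
        (\<forall>j\<in>{1..n}. c (val y) j = \<gamma> j + \<gamma>' j + of_int (m + m') * \<delta> j \<nu>)"
    using assms[unfolded rep_def, THEN conjunct2]
  proof eventually_elim
    case (elim \<nu>)
    then obtain y y' where y: "evaluates_to \<phi> (z \<nu>) y" "y \<noteq> 0"
        "\<forall>j\<in>{1..n}. c (val y) j = \<gamma> j + of_int m * \<delta> j \<nu>"
        "evaluates_to \<phi>' (z \<nu>) y'" "y' \<noteq> 0"
        "\<forall>j\<in>{1..n}. c (val y') j = \<gamma>' j + of_int m' * \<delta> j \<nu>" by blast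
    show ?case
      by (intro exI[of _ "y * y'"] conjI evaluates_to_mult y)
        (use y in \<open>auto simp: c_val_mult algebra_simps\<close>)
  qed
qed (use assms in \<open>auto simp: rep_def L.\<Gamma>_add\<close>)

lemma rep_inverse:
  assumes "rep \<phi> \<gamma> m"
  shows "rep (inverse \<phi>) (\<lambda>j. - \<gamma> j) (- m)"
  unfolding rep_def
proof (intro conjI)
  show "\<forall>\<^sub>F \<nu> in at_top. \<exists>y. evaluates_to (inverse \<phi>) (z \<nu>) y \<and> y \<noteq> 0 \<and>
        (\<forall>j\<in>{1..n}. c (val y) j = - \<gamma> j + of_int (- m) * \<delta> j \<nu>)"
    using assms[unfolded rep_def, THEN conjunct2]
  proof eventually_elim
    case (elim \<nu>)
    then obtain y where y: "evaluates_to \<phi> (z \<nu>) y" "y \<noteq> 0"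
        "\<forall>j\<in>{1..n}. c (val y) j = \<gamma> j + of_int m * \<delta> j \<nu>" by blast
    show ?case
      by (intro exI[of _ "inverse y"] conjI evaluates_to_inverse y)
        (use y in \<open>auto simp: c_val_inverse\<close>)
  qed
qed (use assms in \<open>auto simp: rep_def L.\<Gamma>_minus\<close>)

lemma rep_nonzero:
  assumes "rep \<phi> \<gamma> m"
  shows "\<phi> \<noteq> 0"
proof
  assume \<phi>: "\<phi> = 0"
  obtain \<nu> y where "evaluates_to \<phi> (z \<nu>) y" "y \<noteq> 0"
    using assms eventually_happens'[OF trivial_limit_at_top_linorder] unfolding rep_def by blast
  moreover have "evaluates_to 0 (z \<nu>) 0"
    unfolding evaluates_to_def Zero_fract_def by (intro exI[of _ 0] exI[of _ 1]) simp
  ultimately show False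
    using \<phi> evaluates_to_unique by blast
qed

text \<open>The embedding \<open>to_ac\<close> preserves evaluation, values and gauge, so the result
  over the closure applies to the images of the polynomial and the sequence.\<close>

lemma rep_polynomial:
  assumes p: "p \<noteq> 0"
  shows "\<exists>\<gamma> m. rep (Fract p 1) \<gamma> m"
proof -
  let ?p = "map_poly to_ac p" and ?z = "\<lambda>\<nu>. to_ac (z \<nu>)"
  have poly: "poly ?p (to_ac x) = to_ac (poly p x)" for x
    by (simp add: poly_altdef coeff_map_poly degree_map_poly to_ac_sum)
  have "?p \<noteq> 0"
    using p by (simp add: map_poly_eq_0_iff)
  moreover have "pseudo_convergent vbar ?z"
    using K.pseudo_convergent by (simp add: pseudo_convergent_def extends flip: to_ac_diff)
  ultimately obtain \<gamma> m where \<gamma>: "\<forall>j\<in>{1..n}. \<gamma> j \<in> \<Gamma> j"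
    and m: "\<forall>\<^sub>F \<nu> in at_top. poly ?p (?z \<nu>) \<noteq> 0 \<and>
        (\<forall>j\<in>{1..n}. c (L.val (poly ?p (?z \<nu>))) j = \<gamma> j + real m * c (gauge vbar ?z \<nu>) j)"
    using L.poly_value_eventually[of ?z ?p] alg_closed_imp_poly_has_root by blast
  have "rep (Fract p 1) \<gamma> (int m)"
    unfolding rep_def
  proof (intro conjI \<gamma> eventually_mono[OF m])
    fix \<nu> assume *: "poly ?p (?z \<nu>) \<noteq> 0 \<and>
        (\<forall>j\<in>{1..n}. c (L.val (poly ?p (?z \<nu>))) j = \<gamma> j + real m * c (gauge vbar ?z \<nu>) j)"
    have "evaluates_to (Fract p 1) (z \<nu>) (poly p (z \<nu>))"
      unfolding evaluates_to_def by (intro exI[of _ p] exI[of _ 1]) simp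
    then show "\<exists>y. evaluates_to (Fract p 1) (z \<nu>) y \<and> y \<noteq> 0 \<and>
        (\<forall>j\<in>{1..n}. c (val y) j = \<gamma> j + of_int (int m) * \<delta> j \<nu>)"
      using * by (intro exI[of _ "poly p (z \<nu>)"]) (auto simp: poly val_to_ac gauge_to_ac \<delta>_def)
  qed
  then show ?thesis by blast
qed

lemma rep_exists:
  assumes "\<phi> \<noteq> 0"
  shows "\<exists>\<gamma> m. rep \<phi> \<gamma> m"
proof -
  obtain p q where pq: "\<phi> = Fract p q" "q \<noteq> 0"
    by (cases \<phi>) auto
  with assms have "p \<noteq> 0" by (auto simp: fract_collapse)
  then obtain \<gamma> m \<gamma>' m' where *: "rep (Fract p 1) \<gamma> m" "rep (Fract q 1) \<gamma>' m'"
    using rep_polynomial pq(2) by metis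
  have "\<phi> = Fract p 1 * inverse (Fract q 1)"
    using pq by simp
  then show ?thesis
    using rep_mult[OF *(1) rep_inverse[OF *(2)]] by metis
qed

lemma rep_constant:
  assumes "x \<noteq> 0"
  shows "rep (Fract [:x:] 1) (c (val x)) 0"
  unfolding rep_def
proof (intro conjI always_eventually allI)
  fix \<nu>
  have "evaluates_to (Fract [:x:] 1) (z \<nu>) x"
    unfolding evaluates_to_def by (intro exI[of _ "[:x:]"] exI[of _ 1]) simp
  then show "\<exists>y. evaluates_to (Fract [:x:] 1) (z \<nu>) y \<and> y \<noteq> 0 \<and>
      (\<forall>j\<in>{1..n}. c (val y) j = c (val x) j + of_int 0 * \<delta> j \<nu>)"
    using assms by auto
qed (use assms L.c_mem val_mem in auto)

lemma rep_power:
  assumes "rep \<phi> \<gamma> m"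
  shows "rep (\<phi> ^ N) (\<lambda>j. real N * \<gamma> j) (int N * m)"
proof (induction N)
  case 0
  have "rep (Fract [:1:] 1) (c (val 1)) 0"
    by (rule rep_constant) simp
  moreover have "Fract [:1:] 1 = (1 :: 'k poly fract)"
    by (simp add: fract_collapse flip: one_pCons)
  ultimately show ?case
    by (auto intro: rep_cong simp: K.val_1 L.c_0)
next
  case (Suc N)
  show ?case
    using rep_cong[OF rep_mult[OF assms Suc], of "\<lambda>j. real (Suc N) * \<gamma> j" "int (Suc N) * m"]
    by (simp add: algebra_simps)
qed

lemma rep_power_int:
  assumes "rep \<phi> \<gamma> m"
  shows "\<exists>\<phi>'. rep \<phi>' (\<lambda>j. of_int M * \<gamma> j) (M * m)"
proof (cases M)
  case (nonneg N)
  then show ?thesis using rep_power[OF assms, of N] by auto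
next
  \<comment> \<open>Here \<open>M\<close> is \<open>- int (Suc N)\<close>, hence the exponent
    \<open>Suc N\<close> under the inverse.\<close>
  case (neg N)
  show ?thesis
    by (intro exI[of _ "inverse (\<phi> ^ Suc N)"] rep_cong[OF rep_inverse[OF rep_power[OF assms, of "Suc N"]]])
      (simp_all add: neg algebra_simps)
qed

text \<open>This is where algebraic type enters: with \<open>m = 0\<close> all components of the
  value of \<open>f\<close> would be ultimately constant, and so would the value, as
  \<open>c\<close> is injective.\<close>

lemma rep_not_constant: "\<exists>\<phi> \<gamma> m. rep \<phi> \<gamma> m \<and> m \<noteq> 0"
proof -
  obtain f where f: "\<nexists>a. \<forall>\<^sub>F \<nu> in at_top. v (poly f (z \<nu>)) = a"
    using algebraic by (auto simp: algebraic_type_def)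
  then have "f \<noteq> 0" by auto
  then obtain \<gamma> m where rep: "rep (Fract f 1) \<gamma> m"
    using rep_polynomial by blast
  have "m \<noteq> 0"
  proof
    assume m: "m = 0"
    have ev: "\<forall>\<^sub>F \<nu> in at_top. poly f (z \<nu>) \<noteq> 0 \<and> (\<forall>j\<in>{1..n}. c (val (poly f (z \<nu>))) j = \<gamma> j)"
      using rep[unfolded rep_def, THEN conjunct2]
    proof (rule eventually_mono)
      fix \<nu>
      have "evaluates_to (Fract f 1) (z \<nu>) (poly f (z \<nu>))"
        unfolding evaluates_to_def by (intro exI[of _ f] exI[of _ 1]) simp
      moreover assume "\<exists>y. evaluates_to (Fract f 1) (z \<nu>) y \<and> y \<noteq> 0 \<and>
        (\<forall>j\<in>{1..n}. c (val y) j = \<gamma> j + of_int m * \<delta> j \<nu>)"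
      ultimately show "poly f (z \<nu>) \<noteq> 0 \<and> (\<forall>j\<in>{1..n}. c (val (poly f (z \<nu>))) j = \<gamma> j)"
        using evaluates_to_unique m by fastforce
    qed
    obtain \<mu> where \<mu>: "poly f (z \<mu>) \<noteq> 0" "\<forall>j\<in>{1..n}. c (val (poly f (z \<mu>))) j = \<gamma> j"
      using eventually_happens'[OF trivial_limit_at_top_linorder ev] by blast
    have "\<forall>\<^sub>F \<nu> in at_top. v (poly f (z \<nu>)) = v (poly f (z \<mu>))"
      using ev
    proof (rule eventually_mono)
      fix \<nu> assume "poly f (z \<nu>) \<noteq> 0 \<and> (\<forall>j\<in>{1..n}. c (val (poly f (z \<nu>))) j = \<gamma> j)"
      then show "v (poly f (z \<nu>)) = v (poly f (z \<mu>))"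
        using L.c_inj[OF val_mem val_mem, of "poly f (z \<nu>)" "poly f (z \<mu>)"] \<mu>
        by (simp add: K.v_eq_Fin)
    qed
    then show False using f by blast
  qed
  then show ?thesis using rep by blast
qed

text \<open>Realises every pair up to a nonzero integer factor, which is enough for leading
  positions.\<close>

lemma rep_multiple:
  assumes \<gamma>: "\<And>j. j \<in> {1..n} \<Longrightarrow> \<gamma> j \<in> \<Gamma> j"
  shows "\<exists>\<phi> M. M \<noteq> 0 \<and> rep \<phi> (\<lambda>j. of_int M * \<gamma> j) (M * m)"
proof -
  obtain \<phi>\<^sub>0 \<gamma>\<^sub>0 m\<^sub>0 where rep0: "rep \<phi>\<^sub>0 \<gamma>\<^sub>0 m\<^sub>0" and m0: "m\<^sub>0 \<noteq> 0"
    using rep_not_constant by blast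
  have torsion: "\<exists>\<phi> N. N > 0 \<and> rep \<phi> (\<lambda>j. real N * \<gamma> j) 0"
    if \<gamma>: "\<And>j. j \<in> {1..n} \<Longrightarrow> \<gamma> j \<in> \<Gamma> j" for \<gamma>
  proof -
    obtain y where y: "y \<noteq> 0" "\<And>j. j \<in> {1..n} \<Longrightarrow> c (L.val y) j = \<gamma> j"
      using L.c_surj[of \<gamma>] \<gamma> by blast
    obtain x N where "x \<noteq> 0" "N > 0" "\<And>j. j \<in> {1..n} \<Longrightarrow> c (val x) j = real N * c (L.val y) j"
      using value_torsion[OF y(1)] by blast
    then show ?thesis
      using rep_cong[OF rep_constant, of x "\<lambda>j. real N * \<gamma> j" 0] y(2) by auto
  qed
  obtain \<phi>\<^sub>1 N where rep1: "N > 0" "rep \<phi>\<^sub>1 (\<lambda>j. real N * \<gamma> j) 0"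
    using torsion[OF \<gamma>] by blast
  obtain \<phi>\<^sub>2 N' where rep2: "N' > 0" "rep \<phi>\<^sub>2 (\<lambda>j. real N' * \<gamma>\<^sub>0 j) 0"
    using torsion[of \<gamma>\<^sub>0] rep0 by (auto simp: rep_def)
  \<comment> \<open>A power of \<open>\<phi>\<^sub>0\<close> produces the multiple
    \<open>M * m\<close> of the gauge. The factor \<open>\<phi>\<^sub>4\<close> cancels the constant
    part this brings along, and \<open>\<phi>\<^sub>3\<close> contributes \<open>M\<close> times
    \<open>\<gamma>\<close>.\<close>
  define M where "M = m\<^sub>0 * int N * int N'"
  obtain \<phi>\<^sub>3 where rep3: "rep \<phi>\<^sub>3 (\<lambda>j. of_int (m\<^sub>0 * int N') * (real N * \<gamma> j)) (m\<^sub>0 * int N' * 0)"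
    using rep_power_int[OF rep1(2)] by blast
  obtain \<phi>\<^sub>4 where rep4: "rep \<phi>\<^sub>4 (\<lambda>j. of_int (- m * int N) * (real N' * \<gamma>\<^sub>0 j)) (- m * int N * 0)"
    using rep_power_int[OF rep2(2)] by blast
  obtain \<phi>\<^sub>5 where rep5: "rep \<phi>\<^sub>5 (\<lambda>j. of_int (m * int N * int N') * \<gamma>\<^sub>0 j) (m * int N * int N' * m\<^sub>0)"
    using rep_power_int[OF rep0] by blast
  have "rep (\<phi>\<^sub>3 * \<phi>\<^sub>4 * \<phi>\<^sub>5) (\<lambda>j. of_int M * \<gamma> j) (M * m)"
    by (rule rep_cong[OF rep_mult[OF rep_mult[OF rep3 rep4] rep5]])
      (simp_all add: M_def algebra_simps)
  moreover have "M \<noteq> 0" using m0 rep1(1) rep2(1) by (simp add: M_def)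
  ultimately show ?thesis by blast
qed

end

section \<open>Rank of the valuation defined by the sequence\<close>

locale sequence_valuation = algebraic_sequence v z vbar n \<Gamma> c
  for v :: "'k::field \<Rightarrow> 'g::linordered_ab_group_add extended"
    and z :: "'i::{wellorder,no_top} \<Rightarrow> 'k"
    and vbar :: "'k alg_closure \<Rightarrow> 'g extended" and n \<Gamma> c +
  fixes w :: "'k poly fract \<Rightarrow> 'h::linordered_ab_group_add extended"
  assumes seq_valuation: "is_seq_valuation v z w"
begin

sublocale W: valued w
  using seq_valuation by unfold_locales (simp add: is_seq_valuation_def)

lemma seq_ring_iff: "\<phi> \<in> seq_ring v z \<longleftrightarrow> 0 \<le> w \<phi>"
  using seq_valuation by (auto simp: is_seq_valuation_def)

lemma c_neg: "a \<in> value_group vbar \<Longrightarrow> j \<in> {1..n} \<Longrightarrow> c (- a) j = - c a j"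
  using lex_embedding.minus[OF L.lex_embedding_subgroup[OF L.subgroup_value_group order_refl]] by simp

text \<open>Nonnegativity is expressed as non-positivity of the negative, so that only lexicographic
  positivity has to be handled.\<close>

lemma rep_seq_ring_iff:
  assumes "rep \<phi> \<gamma> m"
  shows "\<phi> \<in> seq_ring v z \<longleftrightarrow>
    (\<forall>\<^sub>F \<nu> in at_top. \<not> lex_less n (\<lambda>_. 0) (\<lambda>j. - \<gamma> j - of_int m * \<delta> j \<nu>))"
proof -
  have "\<forall>\<^sub>F \<nu> in at_top. (\<exists>y. evaluates_to \<phi> (z \<nu>) y \<and> 0 \<le> v y) \<longleftrightarrow>
      \<not> lex_less n (\<lambda>_. 0) (\<lambda>j. - \<gamma> j - of_int m * \<delta> j \<nu>)"
    using assms[unfolded rep_def, THEN conjunct2]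
  proof eventually_elim
    case (elim \<nu>)
    then obtain y where y: "evaluates_to \<phi> (z \<nu>) y" "y \<noteq> 0"
      "\<And>j. j \<in> {1..n} \<Longrightarrow> c (val y) j = \<gamma> j + of_int m * \<delta> j \<nu>" by blast
    have g: "val y \<in> value_group vbar" "- val y \<in> value_group vbar"
      using val_mem[OF y(2)] L.subgroup_value_group by (auto simp: add_subgroup_def)
    have "(\<exists>y. evaluates_to \<phi> (z \<nu>) y \<and> 0 \<le> v y) \<longleftrightarrow> 0 \<le> v y"
      using y(1) evaluates_to_unique by blast
    also have "\<dots> \<longleftrightarrow> \<not> 0 < - val y"
      using y(2) by (simp add: K.v_eq_Fin zero_extended_def not_less)
    also have "0 < - val y \<longleftrightarrow> lex_less n (c 0) (c (- val y))"
      by (rule L.c_less[OF L.zero_mem_value_group g(2)])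
    also have "\<dots> \<longleftrightarrow> lex_less n (\<lambda>_. 0) (\<lambda>j. - \<gamma> j - of_int m * \<delta> j \<nu>)"
      by (rule lex_less_cong) (simp_all add: L.c_0 c_neg[OF g(1)] y(3))
    finally show ?case .
  qed
  then show ?thesis
    unfolding seq_ring_def by (simp add: eventually_subst)
qed

lemma w_nonneg_iff:
  assumes "rep \<phi> \<gamma> m"
  shows "0 \<le> W.val \<phi> \<longleftrightarrow>
    (\<forall>\<^sub>F \<nu> in at_top. \<not> lex_less n (\<lambda>_. 0) (\<lambda>j. - \<gamma> j - of_int m * \<delta> j \<nu>))"
  using rep_seq_ring_iff[OF assms] seq_ring_iff[of \<phi>] W.v_eq_Fin[OF rep_nonzero[OF assms]]
  by (simp add: zero_extended_def)

lemma value_group_rep: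
  assumes "h \<in> value_group w"
  shows "\<exists>\<phi> \<gamma> m. rep \<phi> \<gamma> m \<and> W.val \<phi> = h"
  using assms rep_exists by (metis W.value_groupE)

end

text \<open>\<open>\<Psi>\<close> describes the germ of \<open>\<gamma> + m \<delta>\<close> at the end of the sequence by a constant vector.\<close>
locale germ_embedding = sequence_valuation v z vbar n \<Gamma> c w
  for v :: "'k::field \<Rightarrow> 'g::linordered_ab_group_add extended"
    and z :: "'i::{wellorder,no_top} \<Rightarrow> 'k"
    and vbar :: "'k alg_closure \<Rightarrow> 'g extended" and n \<Gamma> c
    and w :: "'k poly fract \<Rightarrow> 'h::linordered_ab_group_add extended" +
  fixes n' :: nat and \<Psi> :: "(nat \<Rightarrow> real) \<Rightarrow> real \<Rightarrow> nat \<Rightarrow> real"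
  assumes \<Psi>_add: "\<Psi> (\<lambda>j. \<gamma> j + \<gamma>' j) (m + m') k = \<Psi> \<gamma> m k + \<Psi> \<gamma>' m' k"
    and \<Psi>_scale: "\<Psi> (\<lambda>j. a * \<gamma> j) (a * m) k = a * \<Psi> \<gamma> m k"
    and \<Psi>_zero: "(\<And>j. j \<in> {1..n} \<Longrightarrow> \<gamma> j \<in> \<Gamma> j) \<Longrightarrow> (\<And>k. k \<in> {1..n'} \<Longrightarrow> \<Psi> \<gamma> (of_int M) k = 0) \<Longrightarrow>
        M = 0 \<and> (\<forall>j\<in>{1..n}. \<gamma> j = 0)"
    and \<Psi>_pos: "(\<And>j. j \<in> {1..n} \<Longrightarrow> \<gamma> j \<in> \<Gamma> j) \<Longrightarrow> lex_less n' (\<lambda>_. 0) (\<Psi> \<gamma> (of_int M)) \<Longrightarrow>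
        \<forall>\<^sub>F \<nu> in at_top. lex_less n (\<lambda>_. 0) (\<lambda>j. \<gamma> j + of_int M * \<delta> j \<nu>)"
    and \<Psi>_lead: "k \<in> {1..n'} \<Longrightarrow>
        \<exists>\<gamma> M. (\<forall>j\<in>{1..n}. \<gamma> j \<in> \<Gamma> j) \<and> lex_lead n' (\<Psi> \<gamma> (of_int M)) k"
begin

lemma \<Psi>_minus: "\<Psi> (\<lambda>j. - \<gamma> j) (- m) k = - \<Psi> \<gamma> m k"
  using \<Psi>_scale[of "-1" \<gamma> m k] by simp

text \<open>The negated pair is ultimately positive, which excludes membership in the valuation ring
  because \<open>at_top\<close> is a proper filter.\<close>

lemma not_nonneg:
  assumes "rep \<phi> \<gamma> M" "lex_less n' (\<lambda>_. 0) (\<lambda>k. - \<Psi> \<gamma> (of_int M) k)"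
  shows "W.val \<phi> < 0"
proof -
  have "(\<lambda>k. - \<Psi> \<gamma> (of_int M) k) = \<Psi> (\<lambda>j. - \<gamma> j) (of_int (- M))"
    by (simp add: \<Psi>_minus fun_eq_iff)
  then have "\<forall>\<^sub>F \<nu> in at_top. lex_less n (\<lambda>_. 0) (\<lambda>j. - \<gamma> j + of_int (- M) * \<delta> j \<nu>)"
    using assms by (intro \<Psi>_pos) (auto simp: rep_def L.\<Gamma>_minus)
  then have "\<forall>\<^sub>F \<nu> in at_top. lex_less n (\<lambda>_. 0) (\<lambda>j. - \<gamma> j - of_int M * \<delta> j \<nu>)"
    by simp
  then have "\<not> (\<forall>\<^sub>F \<nu> in at_top. \<not> lex_less n (\<lambda>_. 0) (\<lambda>j. - \<gamma> j - of_int M * \<delta> j \<nu>))"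
    using eventually_happens'[OF trivial_limit_at_top_linorder eventually_conj] by blast
  then show ?thesis
    using w_nonneg_iff[OF assms(1)] by simp
qed

lemma w_pos:
  assumes "rep \<phi> \<gamma> M" "lex_less n' (\<lambda>_. 0) (\<Psi> \<gamma> (of_int M))"
  shows "0 < W.val \<phi>"
  using not_nonneg[OF rep_inverse[OF assms(1)]] assms(2)
  by (simp add: \<Psi>_minus W.val_inverse rep_nonzero[OF assms(1)])

text \<open>A vanishing vector comes only from the zero pair, and then both the function and its
  inverse lie in the valuation ring.\<close>

lemma w_zero:
  assumes "rep \<phi> \<gamma> M" "\<And>k. k \<in> {1..n'} \<Longrightarrow> \<Psi> \<gamma> (of_int M) k = 0"
  shows "W.val \<phi> = 0"
proof -
  have nonneg: "0 \<le> W.val \<phi>" if "rep \<phi> \<gamma> M" "M = 0" "\<forall>j\<in>{1..n}. \<gamma> j = 0" for \<phi> \<gamma> M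
  proof -
    have "lex_less n (\<lambda>_. 0) (\<lambda>j. - \<gamma> j - of_int M * \<delta> j \<nu>) \<longleftrightarrow> lex_less n (\<lambda>_. 0) (\<lambda>_. 0)" for \<nu>
      by (rule lex_less_cong) (use that in auto)
    then show ?thesis
      using w_nonneg_iff[OF that(1)] by (simp add: lex_less_def)
  qed
  have *: "M = 0 \<and> (\<forall>j\<in>{1..n}. \<gamma> j = 0)"
    by (rule \<Psi>_zero) (use assms in \<open>auto simp: rep_def\<close>)
  have "0 \<le> W.val \<phi>"
    using nonneg[OF assms(1)] * by simp
  moreover have "0 \<le> W.val (inverse \<phi>)"
    using nonneg[OF rep_inverse[OF assms(1)]] * by simp
  ultimately show ?thesis
    by (simp add: W.val_inverse rep_nonzero[OF assms(1)])
qed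

lemma lex_trichotomy:
  assumes "\<not> lex_less n' (\<lambda>_. 0) x" "\<not> lex_less n' (\<lambda>_. 0) (\<lambda>k. - x k)" "k \<in> {1..n'}"
  shows "x k = 0"
proof (rule ccontr)
  assume "x k \<noteq> 0"
  then obtain l where l: "lex_lead n' x l"
    using lex_lead_exists[of k n' x] assms(3) by blast
  then have "lex_lead n' (\<lambda>k. - x k) l" by (simp add: lex_lead_def)
  then show False
    using assms(1,2) l unfolding lex_less_zero_iff lex_lead_def by (metis linorder_neqE neg_0_less_iff_less)
qed

lemma w_pos_iff:
  assumes "rep \<phi> \<gamma> M"
  shows "0 < W.val \<phi> \<longleftrightarrow> lex_less n' (\<lambda>_. 0) (\<Psi> \<gamma> (of_int M))"
  using w_pos[OF assms] not_nonneg[OF assms] w_zero[OF assms] lex_trichotomy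
  by (metis less_irrefl not_less_iff_gr_or_eq)

lemma w_eq_zero_imp:
  assumes "rep \<phi> \<gamma> M" "W.val \<phi> = 0" "k \<in> {1..n'}"
  shows "\<Psi> \<gamma> (of_int M) k = 0"
  using w_pos[OF assms(1)] not_nonneg[OF assms(1)] lex_trichotomy[OF _ _ assms(3)] assms(2)
  by fastforce

definition \<psi> :: "'h \<Rightarrow> nat \<Rightarrow> real" where
  "\<psi> h = (SOME x. \<exists>\<phi> \<gamma> M. rep \<phi> \<gamma> M \<and> W.val \<phi> = h \<and> x = \<Psi> \<gamma> (of_int M))"

text \<open>Independence of the choice in \<open>\<psi>\<close>: functions of equal value have a
  quotient of value 0, whose vector vanishes on \<open>{1..n'}\<close>.\<close>

lemma \<psi>_rep:
  assumes "rep \<phi> \<gamma> M" "k \<in> {1..n'}"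
  shows "\<psi> (W.val \<phi>) k = \<Psi> \<gamma> (of_int M) k"
proof -
  have "\<exists>x \<phi>' \<gamma>' M'. rep \<phi>' \<gamma>' M' \<and> W.val \<phi>' = W.val \<phi> \<and> x = \<Psi> \<gamma>' (of_int M')"
    using assms(1) by blast
  from someI_ex[OF this] obtain \<phi>' \<gamma>' M' where *: "rep \<phi>' \<gamma>' M'" "W.val \<phi>' = W.val \<phi>"
    "\<psi> (W.val \<phi>) = \<Psi> \<gamma>' (of_int M')"
    unfolding \<psi>_def by blast
  have "rep (\<phi>' * inverse \<phi>) (\<lambda>j. \<gamma>' j + - \<gamma> j) (M' + - M)"
    by (intro rep_mult rep_inverse * assms)
  moreover have "W.val (\<phi>' * inverse \<phi>) = 0"
    using rep_nonzero[OF *(1)] rep_nonzero[OF assms(1)] *(2) by (simp add: W.val_mult W.val_inverse)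
  ultimately have "\<Psi> (\<lambda>j. \<gamma>' j + - \<gamma> j) (of_int (M' + - M)) k = 0"
    using w_eq_zero_imp assms(2) by blast
  then show ?thesis
    using \<Psi>_add[of \<gamma>' "\<lambda>j. - \<gamma> j" "of_int M'" "- of_int M" k] \<Psi>_minus[of \<gamma> "of_int M" k] *(3) by simp
qed

lemma lex_embedding_w: "lex_embedding (value_group w) n' \<psi>"
proof
  show "add_subgroup (value_group w)" by (rule W.subgroup_value_group)
next
  fix a b j assume a: "a \<in> value_group w" and b: "b \<in> value_group w" and j: "j \<in> {1..n'}"
  obtain \<phi> \<gamma> M where A: "rep \<phi> \<gamma> M" "W.val \<phi> = a" using value_group_rep[OF a] by blast
  obtain \<phi>' \<gamma>' M' where B: "rep \<phi>' \<gamma>' M'" "W.val \<phi>' = b" using value_group_rep[OF b] by blast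
  have "W.val (\<phi> * \<phi>') = a + b"
    using rep_nonzero[OF A(1)] rep_nonzero[OF B(1)] A(2) B(2) by (simp add: W.val_mult)
  then show "\<psi> (a + b) j = \<psi> a j + \<psi> b j"
    using \<psi>_rep[OF rep_mult[OF A(1) B(1)] j] \<psi>_rep[OF A(1) j] \<psi>_rep[OF B(1) j] A(2) B(2) by (simp add: \<Psi>_add)
next
  fix a assume a: "a \<in> value_group w"
  obtain \<phi> \<gamma> M where A: "rep \<phi> \<gamma> M" "W.val \<phi> = a" using value_group_rep[OF a] by blast
  have "lex_less n' (\<lambda>_. 0) (\<psi> a) \<longleftrightarrow> lex_less n' (\<lambda>_. 0) (\<Psi> \<gamma> (of_int M))"
    by (rule lex_less_cong) (use \<psi>_rep[OF A(1)] A(2) in auto)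
  then show "0 < a \<longleftrightarrow> lex_less n' (\<lambda>_. 0) (\<psi> a)"
    using w_pos_iff[OF A(1)] A(2) by simp
qed

text \<open>Passing to the multiple by \<open>M\<close> scales the vector by a nonzero number, so
  every leading position of \<open>\<Psi>\<close> occurs in the value group.\<close>

lemma has_rank_w: "has_rank (value_group w) n'"
proof (rule lex_embedding.has_rank_if_all_lead[OF lex_embedding_w])
  fix k assume "k \<in> {1..n'}"
  then obtain \<gamma> m where \<gamma>: "\<forall>j\<in>{1..n}. \<gamma> j \<in> \<Gamma> j" and lead: "lex_lead n' (\<Psi> \<gamma> (of_int m)) k"
    using \<Psi>_lead by blast
  from rep_multiple[of \<gamma> m] \<gamma> obtain \<phi> M where M: "M \<noteq> 0" "rep \<phi> (\<lambda>j. of_int M * \<gamma> j) (M * m)"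
    by blast
  have "\<psi> (W.val \<phi>) l = of_int M * \<Psi> \<gamma> (of_int m) l" if "l \<in> {1..n'}" for l
    using \<psi>_rep[OF M(2) that] by (simp add: \<Psi>_scale)
  then have "lex_lead n' (\<psi> (W.val \<phi>)) k"
    using lead M(1) by (auto simp: lex_lead_def)
  then show "\<exists>g\<in>value_group w. lex_lead n' (\<psi> g) k"
    using W.val_mem rep_nonzero[OF M(2)] by blast
qed

end

lemma lex_less_zeroI:
  "k \<in> {1..n} \<Longrightarrow> (\<And>j. j \<in> {1..<k} \<Longrightarrow> x j = 0) \<Longrightarrow> 0 < x k \<Longrightarrow> lex_less n (\<lambda>_. 0) x"
  by (auto simp: lex_less_zero_iff lex_lead_def)

section \<open>Inserting a new component into the lexicographic product\<close>

context sequence_valuation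
begin

text \<open>Supplies vectors for the positions that do not involve the gauge, to be used with
  \<open>M = 0\<close>.\<close>

lemma lead_in_value_group:
  assumes "has_rank (value_group v) n" "k \<in> {1..n}"
  shows "\<exists>\<gamma>. (\<forall>j\<in>{1..n}. \<gamma> j \<in> \<Gamma> j) \<and> lex_lead n \<gamma> k"
  using lex_embedding.all_lead_if_has_rank[OF lex_embedding assms] L.c_mem value_group_subset by blast

text \<open>The components before \<open>k\<close> ultimately vanish, and component \<open>k\<close>
  converges to a positive number.\<close>

lemma eventually_lex_pos:
  assumes k: "k \<in> {1..n}"
    and const: "\<forall>\<^sub>F \<nu> in at_top. \<forall>j\<in>{1..<k}. \<delta> j \<nu> = t j"
    and lim: "(\<delta> k \<longlongrightarrow> t k) at_top"
    and zero: "\<And>j. j \<in> {1..<k} \<Longrightarrow> \<gamma> j + of_int M * t j = 0"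
    and pos: "0 < \<gamma> k + of_int M * t k"
  shows "\<forall>\<^sub>F \<nu> in at_top. lex_less n (\<lambda>_. 0) (\<lambda>j. \<gamma> j + of_int M * \<delta> j \<nu>)"
proof -
  have "((\<lambda>\<nu>. \<gamma> k + of_int M * \<delta> k \<nu>) \<longlongrightarrow> \<gamma> k + of_int M * t k) at_top"
    by (intro tendsto_intros lim)
  from const order_tendstoD(1)[OF this pos] show ?thesis
    by eventually_elim (use zero k in \<open>auto intro!: lex_less_zeroI[of k]\<close>)
qed

text \<open>Common form of the two cases of rank \<open>n + 1\<close>: an entry \<open>e * m\<close>
  is inserted at position \<open>p\<close>, with \<open>p = i\<close>, \<open>e = 1\<close> for an
  infinite supremum and \<open>p = i + 1\<close>, \<open>e = -1\<close> for an unattained supremum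
  in \<open>\<Gamma> i\<close>.\<close>

lemma has_rank_new_component:
  fixes e :: real
  assumes rank: "has_rank (value_group v) n"
    and p: "p \<in> {1..n + 1}" and t: "\<And>j. j \<in> {1..<p} \<Longrightarrow> t j \<in> \<Gamma> j" and e: "e \<noteq> 0"
    and before: "\<And>\<gamma> M k. k \<in> {1..<p} \<Longrightarrow> (\<And>j. j \<in> {1..<k} \<Longrightarrow> \<gamma> j + of_int M * t j = 0) \<Longrightarrow>
        0 < \<gamma> k + of_int M * t k \<Longrightarrow>
        \<forall>\<^sub>F \<nu> in at_top. lex_less n (\<lambda>_. 0) (\<lambda>j. \<gamma> j + of_int M * \<delta> j \<nu>)"
    and new: "\<And>\<gamma> M. (\<And>j. j \<in> {1..<p} \<Longrightarrow> \<gamma> j + of_int M * t j = 0) \<Longrightarrow> 0 < e * of_int M \<Longrightarrow>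
        \<forall>\<^sub>F \<nu> in at_top. lex_less n (\<lambda>_. 0) (\<lambda>j. \<gamma> j + of_int M * \<delta> j \<nu>)"
  shows "has_rank (value_group w) (n + 1)"
proof -
  \<comment> \<open>After \<open>p\<close> the entries of \<open>\<gamma>\<close> are shifted by one
    and carry no multiple of \<open>m\<close>: they decide only once the entry at \<open>p\<close>,
    and with it \<open>m\<close>, vanishes.\<close>
  define \<Psi> :: "(nat \<Rightarrow> real) \<Rightarrow> real \<Rightarrow> nat \<Rightarrow> real" where
    "\<Psi> \<gamma> m k = (if k < p then \<gamma> k + m * t k else if k = p then e * m else \<gamma> (k - 1))" for \<gamma> m k
  have "germ_embedding v z vbar n \<Gamma> c w (n + 1) \<Psi>"
  proof (intro germ_embedding.intro germ_embedding_axioms.intro sequence_valuation_axioms)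
    fix \<gamma> M
    assume zero: "\<And>k. k \<in> {1..n + 1} \<Longrightarrow> \<Psi> \<gamma> (of_int M) k = 0"
    have M: "M = 0" using zero[OF p] e by (simp add: \<Psi>_def)
    have "\<gamma> j = 0" if j: "j \<in> {1..n}" for j
      using zero[of j] zero[of "j + 1"] j M by (cases "j < p") (auto simp: \<Psi>_def)
    with M show "M = 0 \<and> (\<forall>j\<in>{1..n}. \<gamma> j = 0)" by simp
  next
    fix \<gamma> M
    assume "lex_less (n + 1) (\<lambda>_. 0) (\<Psi> \<gamma> (of_int M))"
    then obtain k where k: "k \<in> {1..n + 1}" "\<And>j. j \<in> {1..<k} \<Longrightarrow> \<Psi> \<gamma> (of_int M) j = 0"
      "0 < \<Psi> \<gamma> (of_int M) k"
      unfolding lex_less_def by metis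
    consider "k < p" | "k = p" | "p < k" by linarith
    then show "\<forall>\<^sub>F \<nu> in at_top. lex_less n (\<lambda>_. 0) (\<lambda>j. \<gamma> j + of_int M * \<delta> j \<nu>)"
    proof cases
      case 1
      show ?thesis
      proof (rule before[of k])
        fix j assume "j \<in> {1..<k}"
        then show "\<gamma> j + of_int M * t j = 0" using k(2)[of j] 1 by (simp add: \<Psi>_def)
      qed (use k 1 in \<open>auto simp: \<Psi>_def\<close>)
    next
      case 2
      show ?thesis
      proof (rule new)
        fix j assume "j \<in> {1..<p}"
        then show "\<gamma> j + of_int M * t j = 0" using k(2)[of j] 2 by (simp add: \<Psi>_def)
      qed (use k 2 in \<open>auto simp: \<Psi>_def\<close>)
    next
      case 3
      have M: "M = 0" using k(2)[of p] p 3 e by (simp add: \<Psi>_def)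
      have "\<gamma> j = 0" if "j \<in> {1..<k - 1}" for j
        using k(2)[of j] k(2)[of "j + 1"] that M by (cases "j < p") (auto simp: \<Psi>_def)
      moreover have "0 < \<gamma> (k - 1)" using k(3) 3 by (simp add: \<Psi>_def)
      ultimately have "lex_less n (\<lambda>_. 0) \<gamma>"
        using k(1) 3 p by (intro lex_less_zeroI[of "k - 1"]) auto
      then show ?thesis using M by simp
    qed
  next
    fix k assume k: "k \<in> {1..n + 1}"
    show "\<exists>\<gamma> M. (\<forall>j\<in>{1..n}. \<gamma> j \<in> \<Gamma> j) \<and> lex_lead (n + 1) (\<Psi> \<gamma> (of_int M)) k"
    proof (cases "k = p")
      case True
      \<comment> \<open>With \<open>M = 1\<close> this cancels all entries before \<open>p\<close>
        and leaves \<open>e\<close> as the first nonzero one.\<close>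
      define \<gamma> where "\<gamma> j = (if j < p then - t j else 0)" for j
      have "\<gamma> j \<in> \<Gamma> j" if "j \<in> {1..n}" for j
        using that t[of j] L.\<Gamma>_minus[OF that] L.\<Gamma>_0[OF that] by (auto simp: \<gamma>_def)
      moreover have "lex_lead (n + 1) (\<Psi> \<gamma> (of_int 1)) k"
        using k True e by (auto simp: lex_lead_def \<Psi>_def \<gamma>_def)
      ultimately show ?thesis by blast
    next
      case False
      \<comment> \<open>The position in the original product, before the insertion at
        \<open>p\<close>.\<close>
      define k' where "k' = (if k < p then k else k - 1)"
      have "k' \<in> {1..n}" using k p False by (auto simp: k'_def)
      then obtain \<gamma> where \<gamma>: "\<forall>j\<in>{1..n}. \<gamma> j \<in> \<Gamma> j" "lex_lead n \<gamma> k'"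
        using lead_in_value_group[OF rank] by blast
      have "lex_lead (n + 1) (\<Psi> \<gamma> (of_int 0)) k"
        unfolding lex_lead_def
      proof (intro conjI ballI)
        fix j assume j: "j \<in> {1..<k}"
        have zero: "\<gamma> l = 0" if "l \<in> {1..<k'}" for l
          using \<gamma>(2) that by (simp add: lex_lead_def)
        have "j \<in> {1..<k'}" if "j < p" using j p False that by (auto simp: k'_def)
        moreover have "j - 1 \<in> {1..<k'}" if "p < j" using j p False that by (auto simp: k'_def)
        ultimately show "\<Psi> \<gamma> (of_int 0) j = 0"
          using zero by (simp add: \<Psi>_def)
      qed (use k False \<gamma>(2) in \<open>auto simp: \<Psi>_def k'_def lex_lead_def split: if_splits\<close>)
      then show ?thesis using \<gamma>(1) by blast
    qed
  qed (auto simp: \<Psi>_def algebra_simps)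
  then show ?thesis by (rule germ_embedding.has_rank_w)
qed

section \<open>Ranks for the possible limits of the first component not settled\<close>

context
  fixes i :: nat and r :: "nat \<Rightarrow> real"
  assumes rank: "has_rank (value_group v) n"
    and i: "i \<in> {1..n}"
    and r: "\<And>j. j \<in> {1..<i} \<Longrightarrow> r j \<in> \<Gamma> j"
    and const: "\<forall>\<^sub>F \<nu> in at_top. \<forall>j\<in>{1..<i}. \<delta> j \<nu> = r j"
begin

lemma tendsto_before:
  assumes "k \<in> {1..<i}"
  shows "(\<delta> k \<longlongrightarrow> r k) at_top"
  by (rule tendsto_eventually) (use const in \<open>rule eventually_mono; use assms in auto\<close>)

lemma const_before:
  assumes "k \<le> i"
  shows "\<forall>\<^sub>F \<nu> in at_top. \<forall>j\<in>{1..<k}. \<delta> j \<nu> = r j"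
  using const by (rule eventually_mono) (use assms in auto)

text \<open>Once the components before \<open>i\<close> cancel, a positive multiple of the gauge
  outweighs any \<open>\<gamma> i\<close>; hence \<open>m\<close> takes its place just before
  \<open>\<gamma> i\<close>.\<close>

lemma has_rank_unbounded:
  assumes "filterlim (\<delta> i) at_top at_top"
  shows "has_rank (value_group w) (n + 1)"
proof (rule has_rank_new_component[OF rank, of i r 1])
  fix \<gamma> :: "nat \<Rightarrow> real" and M :: int
  assume zero: "\<And>j. j \<in> {1..<i} \<Longrightarrow> \<gamma> j + of_int M * r j = 0" and M: "0 < 1 * real_of_int M"
  have "\<forall>\<^sub>F \<nu> in at_top. - \<gamma> i / of_int M < \<delta> i \<nu>"
    using assms by (simp add: filterlim_at_top_dense)
  with const show "\<forall>\<^sub>F \<nu> in at_top. lex_less n (\<lambda>_. 0) (\<lambda>j. \<gamma> j + of_int M * \<delta> j \<nu>)"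
  proof eventually_elim
    case (elim \<nu>)
    then have "0 < \<gamma> i + of_int M * \<delta> i \<nu>"
      using M by (simp add: field_simps)
    then show ?case
      using zero elim(1) i by (intro lex_less_zeroI[of i]) auto
  qed
next
  fix \<gamma> :: "nat \<Rightarrow> real" and M :: int and k
  assume "k \<in> {1..<i}" "\<And>j. j \<in> {1..<k} \<Longrightarrow> \<gamma> j + of_int M * r j = 0" "0 < \<gamma> k + of_int M * r k"
  then show "\<forall>\<^sub>F \<nu> in at_top. lex_less n (\<lambda>_. 0) (\<lambda>j. \<gamma> j + of_int M * \<delta> j \<nu>)"
    using i by (intro eventually_lex_pos[of k r] const_before tendsto_before) auto
qed (use i r in auto)

text \<open>If \<open>\<gamma> i + m * s = 0\<close>, component \<open>i\<close> along the sequence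
  is \<open>m * (\<delta> i \<nu> - s)\<close>, which has the sign of \<open>- m\<close>; hence
  \<open>- m\<close> follows component \<open>i\<close>.\<close>

lemma has_rank_limit_in:
  assumes s: "s \<in> \<Gamma> i" and lim: "(\<delta> i \<longlongrightarrow> s) at_top"
    and less: "\<forall>\<^sub>F \<nu> in at_top. \<delta> i \<nu> < s"
  shows "has_rank (value_group w) (n + 1)"
proof (rule has_rank_new_component[OF rank, of "i + 1" "r(i := s)" "-1"])
  fix \<gamma> :: "nat \<Rightarrow> real" and M :: int
  assume zero: "\<And>j. j \<in> {1..<i + 1} \<Longrightarrow> \<gamma> j + of_int M * (r(i := s)) j = 0"
    and M: "0 < - 1 * real_of_int M"
  have zi: "\<gamma> i + of_int M * s = 0" using zero[of i] i by simp
  have zj: "\<gamma> j + of_int M * r j = 0" if "j \<in> {1..<i}" for j using zero[of j] that by simp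
  from const less show "\<forall>\<^sub>F \<nu> in at_top. lex_less n (\<lambda>_. 0) (\<lambda>j. \<gamma> j + of_int M * \<delta> j \<nu>)"
  proof eventually_elim
    case (elim \<nu>)
    have "of_int M * s < of_int M * \<delta> i \<nu>"
      using M elim(2) by (intro mult_strict_left_mono_neg) auto
    then show ?case
      using zi zj elim(1) i by (intro lex_less_zeroI[of i]) auto
  qed
next
  fix \<gamma> :: "nat \<Rightarrow> real" and M :: int and k
  assume k: "k \<in> {1..<i + 1}" and *: "\<And>j. j \<in> {1..<k} \<Longrightarrow> \<gamma> j + of_int M * (r(i := s)) j = 0"
    "0 < \<gamma> k + of_int M * (r(i := s)) k"
  have "(\<delta> k \<longlongrightarrow> (r(i := s)) k) at_top"
    using lim tendsto_before[of k] k by (cases "k = i") auto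
  moreover have "\<forall>\<^sub>F \<nu> in at_top. \<forall>j\<in>{1..<k}. \<delta> j \<nu> = (r(i := s)) j"
    using const_before[of k] k by (auto elim: eventually_mono)
  ultimately show "\<forall>\<^sub>F \<nu> in at_top. lex_less n (\<lambda>_. 0) (\<lambda>j. \<gamma> j + of_int M * \<delta> j \<nu>)"
    using i k * by (intro eventually_lex_pos[of k "r(i := s)"]) auto
qed (use i r s in auto)

text \<open>Vanishing of \<open>\<gamma> i + m * s\<close> forces \<open>m = 0\<close>, so the
  limits alone decide the sign and no position is added.\<close>

lemma has_rank_limit_not_in:
  assumes s: "s \<notin> \<Gamma> i" and lim: "(\<delta> i \<longlongrightarrow> s) at_top"
  shows "has_rank (value_group w) n"
proof -
  \<comment> \<open>Beyond \<open>i\<close> the default 0 leaves \<open>\<gamma>\<close> unchanged;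
    these entries decide only when \<open>M = 0\<close>.\<close>
  define t where "t j = (if j < i then r j else if j = i then s else 0)" for j
  define \<Psi> :: "(nat \<Rightarrow> real) \<Rightarrow> real \<Rightarrow> nat \<Rightarrow> real" where
    "\<Psi> \<gamma> m k = \<gamma> k + m * t k" for \<gamma> m k
  have M0: "M = 0" if "\<gamma> i \<in> \<Gamma> i" "\<Psi> \<gamma> (of_int M) i = 0" for \<gamma> M
    using not_in_\<Gamma>_multiple[OF i s that(1)] that(2) by (simp add: \<Psi>_def t_def)
  have "germ_embedding v z vbar n \<Gamma> c w n \<Psi>"
  proof (intro germ_embedding.intro germ_embedding_axioms.intro sequence_valuation_axioms)
    fix \<gamma> M
    assume "\<And>j. j \<in> {1..n} \<Longrightarrow> \<gamma> j \<in> \<Gamma> j" and zero: "\<And>k. k \<in> {1..n} \<Longrightarrow> \<Psi> \<gamma> (of_int M) k = 0"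
    then have "M = 0" using M0 i by blast
    then show "M = 0 \<and> (\<forall>j\<in>{1..n}. \<gamma> j = 0)" using zero by (simp add: \<Psi>_def)
  next
    fix \<gamma> M
    assume \<gamma>: "\<And>j. j \<in> {1..n} \<Longrightarrow> \<gamma> j \<in> \<Gamma> j" and pos: "lex_less n (\<lambda>_. 0) (\<Psi> \<gamma> (of_int M))"
    then obtain k where k: "k \<in> {1..n}" "\<And>j. j \<in> {1..<k} \<Longrightarrow> \<Psi> \<gamma> (of_int M) j = 0"
      "0 < \<Psi> \<gamma> (of_int M) k"
      unfolding lex_less_def by metis
    show "\<forall>\<^sub>F \<nu> in at_top. lex_less n (\<lambda>_. 0) (\<lambda>j. \<gamma> j + of_int M * \<delta> j \<nu>)"
    proof (cases "k \<le> i")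
      case True
      have "(\<delta> k \<longlongrightarrow> t k) at_top"
        using lim tendsto_before[of k] k(1) True by (cases "k = i") (auto simp: t_def)
      moreover have "\<forall>\<^sub>F \<nu> in at_top. \<forall>j\<in>{1..<k}. \<delta> j \<nu> = t j"
        using const_before[OF True] by (rule eventually_mono) (use True in \<open>auto simp: t_def\<close>)
      ultimately show ?thesis
        using k by (intro eventually_lex_pos[of k t]) (auto simp: \<Psi>_def)
    next
      case False
      then have "M = 0" using M0 \<gamma>[OF i] k(2)[of i] i by auto
      moreover have "\<Psi> \<gamma> 0 = \<gamma>" by (simp add: \<Psi>_def fun_eq_iff)
      ultimately show ?thesis using pos by simp
    qed
  next
    fix k assume "k \<in> {1..n}"
    then obtain \<gamma> where \<gamma>: "\<forall>j\<in>{1..n}. \<gamma> j \<in> \<Gamma> j" "lex_lead n \<gamma> k"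
      using lead_in_value_group[OF rank] by blast
    have "\<Psi> \<gamma> (of_int 0) = \<gamma>" by (simp add: \<Psi>_def fun_eq_iff)
    with \<gamma> show "\<exists>\<gamma> M. (\<forall>j\<in>{1..n}. \<gamma> j \<in> \<Gamma> j) \<and> lex_lead n (\<Psi> \<gamma> (of_int M)) k" by metis
  qed (auto simp: \<Psi>_def algebra_simps)
  then show ?thesis by (rule germ_embedding.has_rank_w)
qed

end

end

section \<open>The case distinction at component i\<close>

theorem mainTheorem8:
  fixes v :: "'k::field \<Rightarrow> 'g::linordered_ab_group_add extended"
    and vbar :: "'k alg_closure \<Rightarrow> 'g extended"
    and n :: nat
    and \<Gamma> :: "nat \<Rightarrow> real set"
    and c :: "'g \<Rightarrow> nat \<Rightarrow> real"
    and z :: "'i::{wellorder,no_top} \<Rightarrow> 'k"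
    and w :: "'k poly fract \<Rightarrow> 'h::linordered_ab_group_add extended"
    and i :: nat
    and r :: "nat \<Rightarrow> real"
    and N :: "nat \<Rightarrow> 'i"
    and \<delta> :: "nat \<Rightarrow> 'i \<Rightarrow> real"
    and r\<^sub>i :: ereal
  assumes "is_valuation v"
    and "1 \<le> n" and "has_rank (value_group v) n"
    and "is_valuation vbar" and "\<And>x. vbar (to_ac x) = v x"
    and "\<And>j. j \<in> {1..n} \<Longrightarrow> add_subgroup (\<Gamma> j)"
    and "lex_identification (value_group vbar) n \<Gamma> c"
    and "pseudo_convergent v z" and "algebraic_type v z"
    and "is_seq_valuation v z w"
    and delta: "\<And>j \<nu>. \<delta> j \<nu> = c (gauge v z \<nu>) j"
    and "i \<in> {1..n}"
    and "N 0 = index_zero"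
    and "\<And>j. j \<in> {1..<i} \<Longrightarrow>
           r j \<in> \<Gamma> j \<and> N (j - 1) \<le> N j \<and>
           (SUP \<nu>\<in>{N (j - 1)..}. ereal (\<delta> j \<nu>)) = ereal (r j) \<and>
           (\<forall>\<nu>\<ge>N j. \<delta> j \<nu> = r j)"
    and r_i: "r\<^sub>i = (SUP \<nu>\<in>{N (i - 1)..}. ereal (\<delta> i \<nu>))"
  defines "case_a \<equiv> r\<^sub>i = \<infinity>"
    and "case_b \<equiv> (\<exists>s. s \<notin> \<Gamma> i \<and> r\<^sub>i = ereal s)"
    and "case_c \<equiv> (\<exists>s\<in>\<Gamma> i. r\<^sub>i = ereal s \<and> (\<forall>\<nu>\<ge>N (i - 1). \<delta> i \<nu> < s))"
    and "case_d \<equiv> (\<exists>s\<in>\<Gamma> i. r\<^sub>i = ereal s \<and>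
                     (\<exists>\<nu>\<^sub>i\<ge>N (i - 1). \<forall>\<nu>\<ge>\<nu>\<^sub>i. \<delta> i \<nu> = s))"
  shows "mono_on {N (i - 1)..} (\<delta> i) \<and>
         r\<^sub>i \<noteq> - \<infinity> \<and>
         (case_a \<longrightarrow> has_rank (value_group w) (n + 1)) \<and>
         (case_b \<longrightarrow> has_rank (value_group w) n) \<and>
         (case_c \<longrightarrow> has_rank (value_group w) (n + 1)) \<and>
         (\<not> case_a \<and> \<not> case_b \<and> \<not> case_c \<longrightarrow> case_d) \<and>
         (i = n \<longrightarrow> \<not> case_d)"
proof -
  interpret S: sequence_valuation v z vbar n \<Gamma> c w
    by unfold_locales (use assms in auto)
  have \<delta>: "S.\<delta> = \<delta>" by (simp add: fun_eq_iff S.\<delta>_def delta)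
  note i = \<open>i \<in> {1..n}\<close>
  note before = assms(14)
  define \<mu> where "\<mu> = N (i - 1)"
  \<comment> \<open>The inequalities between consecutive indices chain up, so from
    \<open>\<mu>\<close> on all earlier components are constant.\<close>
  have N: "N j \<le> \<mu>" if "j < i" for j
  proof -
    have "k < i \<Longrightarrow> N j \<le> N k" if "j \<le> k" for k
      using that
    proof (induction k rule: dec_induct)
      case (step k)
      then show ?case using before[of "Suc k"] by auto
    qed simp
    then show ?thesis using that by (simp add: \<mu>_def)
  qed
  have const: "\<delta> j \<nu> = r j" if "j \<in> {1..<i}" "\<mu> \<le> \<nu>" for j \<nu>
    using before[OF that(1)] N[of j] that by auto
  have lex: "lex_less n (\<lambda>j. \<delta> j \<nu>) (\<lambda>j. \<delta> j \<nu>')" if "\<nu> < \<nu>'" for \<nu> \<nu>'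
    using S.K.gauge_strict_mono[OF that] S.value_group_subset S.K.gauge_mem
      S.L.c_less[of "gauge v z \<nu>" "gauge v z \<nu>'"] by (auto simp: delta lex_less_def)
  have mono_less: "\<delta> i \<nu> \<le> \<delta> i \<nu>'" if \<nu>: "\<mu> \<le> \<nu>" "\<nu> < \<nu>'" for \<nu> \<nu>'
  proof -
    obtain k where k: "k \<in> {1..n}" "\<forall>j\<in>{1..<k}. \<delta> j \<nu> = \<delta> j \<nu>'" "\<delta> k \<nu> < \<delta> k \<nu>'"
      using lex[OF \<nu>(2)] by (auto simp: lex_less_def)
    \<comment> \<open>The gauge increases strictly, but no component before \<open>i\<close> changes
      any more, so the first change is at \<open>i\<close> or later.\<close>
    have "\<not> k < i"
      using k const[of k \<nu>] const[of k \<nu>'] \<nu> by auto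
    then show ?thesis
      using k i by (cases "k = i") auto
  qed
  have mono: "\<delta> i \<nu> \<le> \<delta> i \<nu>'" if "\<mu> \<le> \<nu>" "\<nu> \<le> \<nu>'" for \<nu> \<nu>'
    using mono_less[of \<nu> \<nu>'] that by (cases "\<nu> = \<nu>'") auto
  have upper: "ereal (\<delta> i \<nu>) \<le> r\<^sub>i" if "\<mu> \<le> \<nu>" for \<nu>
    unfolding r_i using that by (intro SUP_upper) (simp add: \<mu>_def)
  have "r\<^sub>i \<noteq> - \<infinity>"
    using upper[of \<mu>] by auto
  \<comment> \<open>Monotonicity makes a bound once exceeded stay exceeded. This yields divergence
    for an infinite supremum and convergence for a real one.\<close>
  have ev_greater: "\<forall>\<^sub>F \<nu> in at_top. a < \<delta> i \<nu>" if a: "ereal a < r\<^sub>i" for a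
  proof -
    obtain \<nu> where \<nu>: "\<mu> \<le> \<nu>" "a < \<delta> i \<nu>"
      using a unfolding r_i less_SUP_iff by (auto simp: \<mu>_def)
    have "a < \<delta> i \<nu>'" if "\<nu> \<le> \<nu>'" for \<nu>'
      using mono[OF \<nu>(1) that] \<nu>(2) by simp
    then show ?thesis by (auto simp: eventually_at_top_linorder)
  qed
  have lim: "(\<delta> i \<longlongrightarrow> s) at_top" if "r\<^sub>i = ereal s" for s
  proof (rule increasing_tendsto)
    show "\<forall>\<^sub>F \<nu> in at_top. \<delta> i \<nu> \<le> s"
      using eventually_ge_at_top[of \<mu>] by (rule eventually_mono) (use upper that in auto)
  qed (use ev_greater that in auto)
  have ev_const: "\<forall>\<^sub>F \<nu> in at_top. \<forall>j\<in>{1..<i}. S.\<delta> j \<nu> = r j"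
    using eventually_ge_at_top[of \<mu>] by (rule eventually_mono) (use const \<delta> in auto)
  note rank_facts = assms(3) i conjunct1[OF before] ev_const
  have "mono_on {N (i - 1)..} (\<delta> i)"
    using mono by (auto intro!: mono_onI simp: \<mu>_def)
  moreover have "has_rank (value_group w) (n + 1)" if case_a
  proof (rule S.has_rank_unbounded[OF rank_facts])
    show "filterlim (S.\<delta> i) at_top at_top"
      using that ev_greater by (simp add: case_a_def \<delta> filterlim_at_top_dense)
  qed
  moreover have "has_rank (value_group w) n" if case_b
    using that S.has_rank_limit_not_in[OF rank_facts] lim by (auto simp: case_b_def \<delta>)
  moreover have "has_rank (value_group w) (n + 1)" if case_c
  proof -
    obtain s where s: "s \<in> \<Gamma> i" "r\<^sub>i = ereal s" "\<forall>\<nu>\<ge>\<mu>. \<delta> i \<nu> < s"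
      using \<open>case_c\<close> by (auto simp: case_c_def \<mu>_def)
    show ?thesis
    proof (rule S.has_rank_limit_in[OF rank_facts s(1)])
      show "(S.\<delta> i \<longlongrightarrow> s) at_top"
        unfolding \<delta> by (rule lim[OF s(2)])
      show "\<forall>\<^sub>F \<nu> in at_top. S.\<delta> i \<nu> < s"
        unfolding \<delta> using eventually_ge_at_top[of \<mu>] by (rule eventually_mono) (use s(3) in auto)
    qed
  qed
  moreover have case_d if not: "\<not> case_a" "\<not> case_b" "\<not> case_c"
  proof -
    obtain s where s: "r\<^sub>i = ereal s"
      using \<open>\<not> case_a\<close> \<open>r\<^sub>i \<noteq> - \<infinity>\<close> by (cases r\<^sub>i) (auto simp: case_a_def)
    have s_in: "s \<in> \<Gamma> i" using not(2) s by (auto simp: case_b_def)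
    \<comment> \<open>Excluding the unattained case gives an index where \<open>s\<close> is
      reached; monotonicity and the upper bound \<open>s\<close> then fix the component.\<close>
    then obtain \<nu> where \<nu>: "\<mu> \<le> \<nu>" "s \<le> \<delta> i \<nu>"
      using not(3) s by (auto simp: case_c_def \<mu>_def not_less)
    have "\<delta> i \<nu>' = s" if "\<nu> \<le> \<nu>'" for \<nu>'
      using mono[OF \<nu>(1) that] \<nu>(2) upper[OF order_trans[OF \<nu>(1) that]] s by simp
    then show ?thesis
      using s_in s \<nu>(1) unfolding case_d_def \<mu>_def by blast
  qed
  \<comment> \<open>All \<open>n\<close> components would be constant from some index on, against
    the strict increase of the gauge.\<close>
  moreover have "\<not> case_d" if "i = n"
  proof
    assume case_d
    then obtain s \<nu> where \<nu>: "\<mu> \<le> \<nu>" "\<forall>\<nu>'\<ge>\<nu>. \<delta> i \<nu>' = s"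
      by (auto simp: case_d_def \<mu>_def)
    have less: "\<nu> < index_succ \<nu>" by (rule less_index_succ)
    obtain k where k: "k \<in> {1..n}" "\<delta> k \<nu> < \<delta> k (index_succ \<nu>)"
      using lex[OF less] by (auto simp: lex_less_def)
    show False
      using k const[of k \<nu>] const[of k "index_succ \<nu>"] \<nu> less \<open>i = n\<close> by (cases "k = i") auto
  qed
  ultimately show ?thesis
    using \<open>r\<^sub>i \<noteq> - \<infinity>\<close> by blast
qed

end
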